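(* Let $n\ge 2$ and $m\ge 2$ be integers. The number of regular tame friezes of width $m$ over the ring $\mathbb{Z}/n\mathbb{Z}$ is \[ \prod_{p\mid n}\Phi_m\bigl(p^{\nu_p(n)}\bigr), \] the product running over the prime divisors $p$ of $n$, where for a prime $p$ and integer $r\ge1$: if $m=2k+1$ then $\Phi_m(p^r)=p^{(r-1)(m-3)}[k]_{p^2}$; and if $m=2k$ then \[ \Phi_m(p^r)= \begin{cases} p^{(r-1)(m-3)}(p-1)\binom{k}{2}_{p} & \text{if $k$ is even and $p\ne 2$},\\[2pt] p^{(r-1)(m-3)}\Bigl((p-1)\binom{k}{2}_{p}+p^{k-1}-1\Bigr) & \text{if $k$ is even, $p=2$ and $r\ne1$},\\[2pt] p^{(r-1)(m-3)}\Bigl((p-1)\Bigl(\binom{k}{2}_{p}+[r-1]_{p^{2-k}}\Bigr)+p^{k-1}\Bigr) & \text{otherwise}. \end{cases} \]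
   Context: For a prime $p$, $\nu_p(n)$ is the exponent of $p$ in the prime factorisation of $n$. For a nonzero rational $q$ and integer $j\ge0$, $[j]_q=1+q+\dots+q^{j-1}$ (so $[j]_q=(q^j-1)/(q-1)$ for $q\ne1$ and $[j]_1=j$), and $\binom{k}{2}_{q}=\frac{(q^k-1)(q^{k-1}-1)}{(q-1)(q^2-1)}$ for an integer $q>1$. Let $R=\mathbb{Z}/n\mathbb{Z}$. A frieze of width $m$ over $R$ is a family of entries $E(u,v)\in R$ indexed by all pairs of integers $(u,v)$ with $0\le v-u\le m$ (an array of $m+1$ bi-infinite rows, entry $E(u,v)$ in row $v-u$), such that $E(u,u)=E(u,u+m)=0$ for all $u$, and for all integers $u,v$ with $1\le v-u\le m-1$, $E(u,v)E(u+1,v+1)-E(u+1,v)E(u,v+1)=1$ in $R$. It is tame if for all integers $u,v$ with $2\le v-u\le m-2$, $\det\bigl(E(u+i,v+j)\bigr)_{i,j=0,1,2}=0$ in $R$. It is regular if the second and second-last rows consist entirely of $1$'s, i.e. $E(u,u+1)=E(u,u+m-1)=1$ for all $u$. Friezes are counted as families of entries. *)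

theory Defs
  imports "HOL-Number_Theory.Number_Theory"
begin

definition gauss_int :: "nat \<Rightarrow> rat \<Rightarrow> rat" where
  "gauss_int j q = (\<Sum>i<j. q ^ i)"

text \<open>Only used for \<open>q > 1\<close> and \<open>k \<ge> 1\<close>, so the divisor is nonzero and the subtraction
  in the exponent does not truncate.\<close>

definition gauss_binomial2 :: "nat \<Rightarrow> rat \<Rightarrow> rat" where
  "gauss_binomial2 k q = ((q ^ k - 1) * (q ^ (k - 1) - 1)) / ((q - 1) * (q ^ 2 - 1))"

definition det3 :: "('a, 'b) ring_scheme \<Rightarrow> (nat \<Rightarrow> nat \<Rightarrow> 'a) \<Rightarrow> 'a" where
  "det3 R A =
     A 0 0 \<otimes>\<^bsub>R\<^esub> (A 1 1 \<otimes>\<^bsub>R\<^esub> A 2 2 \<ominus>\<^bsub>R\<^esub> A 1 2 \<otimes>\<^bsub>R\<^esub> A 2 1)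
     \<ominus>\<^bsub>R\<^esub> A 0 1 \<otimes>\<^bsub>R\<^esub> (A 1 0 \<otimes>\<^bsub>R\<^esub> A 2 2 \<ominus>\<^bsub>R\<^esub> A 1 2 \<otimes>\<^bsub>R\<^esub> A 2 0)
     \<oplus>\<^bsub>R\<^esub> A 0 2 \<otimes>\<^bsub>R\<^esub> (A 1 0 \<otimes>\<^bsub>R\<^esub> A 2 1 \<ominus>\<^bsub>R\<^esub> A 1 1 \<otimes>\<^bsub>R\<^esub> A 2 0)"

text \<open>The entries of a frieze are indexed by the strip below only. A frieze is an extensional
  function on the strip, so that two friezes are equal iff all their entries agree.\<close>

definition strip :: "nat \<Rightarrow> (int \<times> int) set" where
  "strip m = {(u, v). 0 \<le> v - u \<and> v - u \<le> int m}"

definition is_frieze :: "('a, 'b) ring_scheme \<Rightarrow> nat \<Rightarrow> (int \<times> int \<Rightarrow> 'a) \<Rightarrow> bool" where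
  "is_frieze R m E \<longleftrightarrow>
     E \<in> strip m \<rightarrow>\<^sub>E carrier R \<and>
     (\<forall>u. E (u, u) = \<zero>\<^bsub>R\<^esub> \<and> E (u, u + int m) = \<zero>\<^bsub>R\<^esub>) \<and>
     (\<forall>u v. 1 \<le> v - u \<and> v - u \<le> int m - 1 \<longrightarrow>
        E (u, v) \<otimes>\<^bsub>R\<^esub> E (u + 1, v + 1) \<ominus>\<^bsub>R\<^esub> E (u + 1, v) \<otimes>\<^bsub>R\<^esub> E (u, v + 1) = \<one>\<^bsub>R\<^esub>)"

definition is_tame :: "('a, 'b) ring_scheme \<Rightarrow> nat \<Rightarrow> (int \<times> int \<Rightarrow> 'a) \<Rightarrow> bool" where
  "is_tame R m E \<longleftrightarrow>
     (\<forall>u v. 2 \<le> v - u \<and> v - u \<le> int m - 2 \<longrightarrow>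
        det3 R (\<lambda>i j. E (u + int i, v + int j)) = \<zero>\<^bsub>R\<^esub>)"

definition is_regular :: "('a, 'b) ring_scheme \<Rightarrow> nat \<Rightarrow> (int \<times> int \<Rightarrow> 'a) \<Rightarrow> bool" where
  "is_regular R m E \<longleftrightarrow>
     (\<forall>u. E (u, u + 1) = \<one>\<^bsub>R\<^esub> \<and> E (u, u + int m - 1) = \<one>\<^bsub>R\<^esub>)"

definition regular_tame_friezes ::
  "('a, 'b) ring_scheme \<Rightarrow> nat \<Rightarrow> (int \<times> int \<Rightarrow> 'a) set" where
  "regular_tame_friezes R m = {E. is_frieze R m E \<and> is_tame R m E \<and> is_regular R m E}"

text \<open>\<open>Phi m p r\<close> stands for \<open>\<Phi>\<^sub>m(p\<^sup>r)\<close>. For \<open>m = 2\<close> the exponent \<open>(r - 1)(m - 3)\<close>, and for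
  \<open>k > 2\<close> the exponent \<open>2 - k\<close>, may be negative; hence rational values and integer exponents.\<close>

definition Phi :: "nat \<Rightarrow> nat \<Rightarrow> nat \<Rightarrow> rat" where
  "Phi m p r =
     (let k = m div 2;
          q = (of_nat p :: rat);
          c = q powi ((int r - 1) * (int m - 3))
      in if odd m then c * gauss_int k (q ^ 2)
         else if even k \<and> p \<noteq> 2 then c * ((q - 1) * gauss_binomial2 k q)
         else if even k \<and> p = 2 \<and> r \<noteq> 1
              then c * ((q - 1) * gauss_binomial2 k q + q ^ (k - 1) - 1)
         else c * ((q - 1) * (gauss_binomial2 k q + gauss_int (r - 1) (q powi (2 - int k)))
                   + q ^ (k - 1)))"

end

theory Submission
  imports Defs
begin

text \<open>
  A regular tame frieze satisfies the three-term recurrence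
  \<open>E(u, v + 1) = c(v) E(u, v) - E(u, v - 1)\<close> with \<open>c(v) = E(v - 1, v + 1)\<close>, and \<open>c\<close> is \<open>m\<close>-periodic
  with \<open>c(m)\<close> determined by \<open>c(1), \<dots>, c(m - 1)\<close>. Hence friezes correspond to walks with steps
  \<open>(a, b) \<mapsto> (b, c b - a)\<close> of length \<open>m - 1\<close> from \<open>(0, 1)\<close> to \<open>(1, 0)\<close>, whose number is multiplicative
  in \<open>n\<close> by the Chinese remainder theorem.

  Modulo \<open>p\<^sup>r\<close>, let \<open>S(k, b)\<close> be the number of walks of length \<open>k\<close> to \<open>(1, 0)\<close> from some \<open>(b, x)\<close>, for a
  unit \<open>b\<close>. Two steps through a nonunit \<open>x\<close> lead to units \<open>c x - b\<close>, so
  \<open>S(k + 2, b) = \<Sum> S(k + 1, x) + (K S(k, -))(b)\<close>, where the sum is over units \<open>x\<close> and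
  \<open>(K F)(b) = \<Sum> F(c x - b)\<close> over all \<open>c\<close> and all nonunits \<open>x\<close>. Up to the sign change \<open>b \<mapsto> -b\<close>, the
  operator \<open>K\<close> is diagonalised by the averages over residue classes modulo \<open>p\<^sup>j\<close>: on functions that are
  periodic modulo \<open>p\<^sup>j\<close> with mean zero on each class modulo \<open>p\<^sup>j\<^sup>-\<^sup>1\<close> its eigenvalue is \<open>p\<^sup>2\<^sup>r\<^sup>-\<^sup>j\<close>, and on
  constants it is \<open>p\<^sup>2\<^sup>r\<^sup>-\<^sup>1\<close>. Since \<open>S(0, -)\<close> is the indicator function of \<open>1\<close>, this gives \<open>S(m - 2, 1)\<close>
  in closed form; the parity of \<open>m\<close> and the sign explain the case distinction.
\<close>

section \<open>Sums over residues\<close>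

lemma bij_betw_affine_mod:
  fixes n u t :: int
  assumes n: "n > 0" and "coprime u n"
  shows "bij_betw (\<lambda>c. (u * c + t) mod n) {0..<n} {0..<n}"
proof -
  have inj: "inj_on (\<lambda>c. (u * c + t) mod n) {0..<n}"
  proof (rule inj_onI)
    fix x y assume xy: "x \<in> {0..<n}" "y \<in> {0..<n}" and eq: "(u * x + t) mod n = (u * y + t) mod n"
    from eq have "[u * x = u * y] (mod n)"
      by (metis cong_add_rcancel cong_def)
    then have "[x = y] (mod n)"
      using assms by (simp add: cong_mult_lcancel)
    with xy show "x = y" by (simp add: cong_def)
  qed
  have "(\<lambda>c. (u * c + t) mod n) ` {0..<n} \<subseteq> {0..<n}" using n by auto
  with inj have "(\<lambda>c. (u * c + t) mod n) ` {0..<n} = {0..<n}"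
    by (simp add: card_image card_subset_eq)
  with inj show ?thesis by (simp add: bij_betw_def)
qed

lemma sum_residues_affine:
  fixes n u t :: int and f :: "int \<Rightarrow> 'a :: comm_monoid_add"
  assumes "n > 0" and "coprime u n" and per: "\<And>x. f (x mod n) = f x"
  shows "(\<Sum>c\<in>{0..<n}. f (u * c + t)) = (\<Sum>c\<in>{0..<n}. f c)"
proof -
  have "(\<Sum>c\<in>{0..<n}. f (u * c + t)) = (\<Sum>c\<in>{0..<n}. f ((u * c + t) mod n))"
    by (simp add: per)
  also have "\<dots> = (\<Sum>c\<in>{0..<n}. f c)"
    by (rule sum.reindex_bij_betw[OF bij_betw_affine_mod[OF assms(1,2)]])
  finally show ?thesis .
qed

lemma bij_betw_mod_coprime:
  fixes a b :: int
  assumes a: "a > 0" and b: "b > 0" and "coprime a b"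
  shows "bij_betw (\<lambda>c. (c mod a, c mod b)) {0..<a * b} ({0..<a} \<times> {0..<b})"
proof -
  have inj: "inj_on (\<lambda>c. (c mod a, c mod b)) {0..<a * b}"
  proof (rule inj_onI)
    fix x y assume xy: "x \<in> {0..<a * b}" "y \<in> {0..<a * b}"
      and eq: "(x mod a, x mod b) = (y mod a, y mod b)"
    from eq have "[x = y] (mod a)" "[x = y] (mod b)" by (auto simp: cong_def)
    then have "[x = y] (mod a * b)" using assms(3) by (simp add: coprime_cong_mult)
    with xy show "x = y" by (simp add: cong_def)
  qed
  have sub: "(\<lambda>c. (c mod a, c mod b)) ` {0..<a * b} \<subseteq> {0..<a} \<times> {0..<b}" using a b by auto
  have "card ({0..<a} \<times> {0..<b}) = card {0..<a * b}"
    using a b by (simp add: card_cartesian_product nat_mult_distrib)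
  with inj sub have "(\<lambda>c. (c mod a, c mod b)) ` {0..<a * b} = {0..<a} \<times> {0..<b}"
    by (intro card_subset_eq) (auto simp: card_image)
  with inj show ?thesis by (simp add: bij_betw_def)
qed

lemma sum_residues_mult:
  fixes a b :: int and f g :: "int \<Rightarrow> 'a :: comm_semiring_0"
  assumes "a > 0" "b > 0" "coprime a b"
    and f: "\<And>x. f (x mod a) = f x" and g: "\<And>x. g (x mod b) = g x"
  shows "(\<Sum>c\<in>{0..<a * b}. f c * g c) = (\<Sum>c\<in>{0..<a}. f c) * (\<Sum>c\<in>{0..<b}. g c)"
proof -
  have "(\<Sum>c\<in>{0..<a * b}. f c * g c)
      = (\<Sum>c\<in>{0..<a * b}. (\<lambda>(x, y). f x * g y) (c mod a, c mod b))"
    by (simp add: f g)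
  also have "\<dots> = (\<Sum>(x, y)\<in>{0..<a} \<times> {0..<b}. f x * g y)"
    by (rule sum.reindex_bij_betw[OF bij_betw_mod_coprime[OF assms(1-3)]])
  finally show ?thesis by (simp add: sum_product sum.cartesian_product)
qed

section \<open>Counting walks\<close>

text \<open>Values are rational because the closed forms below divide by \<open>phi\<close> and by
  powers of \<open>P\<close>. The endpoints are unreduced integers; only their classes matter, by
  \<open>walks_cong\<close>.\<close>

fun walks :: "int \<Rightarrow> nat \<Rightarrow> int \<Rightarrow> int \<Rightarrow> rat" where
  "walks n 0 a b = of_bool ([a = 1] (mod n) \<and> [b = 0] (mod n))"
| "walks n (Suc k) a b = (\<Sum>c\<in>{0..<n}. walks n k b (c * b - a))"

lemma walks_cong:
  "[a = a'] (mod n) \<Longrightarrow> [b = b'] (mod n) \<Longrightarrow> walks n k a b = walks n k a' b'"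
proof (induction k arbitrary: a a' b b')
  case 0
  then have "[a = 1] (mod n) \<longleftrightarrow> [a' = 1] (mod n)" "[b = 0] (mod n) \<longleftrightarrow> [b' = 0] (mod n)"
    by (auto simp: cong_def)
  then show ?case by simp
next
  case (Suc k)
  show ?case
    unfolding walks.simps
    by (intro sum.cong refl Suc.IH Suc.prems cong_diff cong_mult cong_refl)
qed

text \<open>By the Chinese remainder theorem each step coefficient is an independent pair of
  coefficients modulo \<open>a\<close> and modulo \<open>b\<close>, and the end condition splits
  likewise.\<close>

lemma walks_mult:
  assumes "a > 0" "b > 0" "coprime a b"
  shows "walks (a * b) k x y = walks a k x y * walks b k x y"
proof (induction k arbitrary: x y)
  case 0
  have "[z = w] (mod a * b) \<longleftrightarrow> [z = w] (mod a) \<and> [z = w] (mod b)" for z w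
    using assms(3) by (meson coprime_cong_mult cong_dvd_modulus dvd_triv_left dvd_triv_right)
  then show ?case by auto
next
  case (Suc k)
  have *: "[(c mod n) * y - x = c * y - x] (mod n)" for c n
    by (intro cong_diff cong_mult cong_refl) (simp add: cong_def)
  show ?case
    unfolding walks.simps Suc.IH
    by (rule sum_residues_mult[OF assms]) (auto intro: walks_cong *)
qed

lemma walks_1: "walks 1 k a b = 1"
  by (induction k arbitrary: a b) auto

lemma walks_prod:
  assumes "finite P" "\<And>p. p \<in> P \<Longrightarrow> prime p"
  shows "walks (\<Prod>p\<in>P. int p ^ e p) k a b = (\<Prod>p\<in>P. walks (int p ^ e p) k a b)"
  using assms
proof (induction P rule: finite_induct)
  case empty
  then show ?case by (simp add: walks_1)
next
  case (insert q P)
  have "coprime (int q ^ e q) (int p ^ e p)" if "p \<in> P" for p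
    using insert that by (auto intro!: primes_coprime)
  then have "coprime (int q ^ e q) (\<Prod>p\<in>P. int p ^ e p)"
    by (rule prod_coprime_right)
  moreover have "(\<Prod>p\<in>P. int p ^ e p) > 0"
    using insert.prems by (intro prod_pos) (auto simp: prime_gt_0_nat)
  moreover have "int q ^ e q > 0" using insert.prems by (simp add: prime_gt_0_nat)
  ultimately show ?case using insert by (simp add: walks_mult)
qed

lemma walks_prime_factors:
  assumes "n > 0"
  shows "walks (int n) k a b = (\<Prod>p\<in>prime_factors n. walks (int p ^ multiplicity p n) k a b)"
proof -
  have n: "n = (\<Prod>p\<in>prime_factors n. p ^ multiplicity p n)"
    using prod_prime_factors[of n] assms by simp
  have "int n = (\<Prod>p\<in>prime_factors n. int p ^ multiplicity p n)"
    by (subst n) simp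
  then show ?thesis
    using walks_prod[of "prime_factors n" "\<lambda>p. multiplicity p n"]
    by (simp add: in_prime_factors_imp_prime)
qed

section \<open>Walks modulo a prime power\<close>

text \<open>The modulus is \<open>q = p\<^sup>r\<close> with \<open>r = s + 1\<close>.\<close>

locale prime_power_modulus =
  fixes p :: int and s :: nat
  assumes prime_p: "prime p"
begin

definition q :: int where "q = p ^ Suc s"
definition P :: rat where "P = of_int p"
definition phi :: rat where "phi = P ^ s * (P - 1)"

section \<open>Counting units and multiples modulo a prime power\<close>

lemma p_gt_1: "p > 1" using prime_p by (simp add: prime_gt_1_int)
lemma q_pos: "q > 0" using p_gt_1 by (simp add: q_def)
lemma P_gt_1: "P > 1" using p_gt_1 by (simp add: P_def)
lemma P_pos: "P > 0" using P_gt_1 by simp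
lemma phi_pos: "phi > 0" using P_gt_1 by (simp add: phi_def)
lemma p_dvd_q: "p dvd q" by (simp add: q_def)
lemma of_int_q: "of_int q = P ^ Suc s" by (simp add: q_def P_def)

lemma coprime_q: "\<not> p dvd b \<Longrightarrow> coprime b q"
  using prime_p by (metis coprime_commute coprime_power_left_iff prime_imp_coprime q_def)

lemma dvd_mod_q: "j \<le> Suc s \<Longrightarrow> p ^ j dvd x mod q \<longleftrightarrow> p ^ j dvd x"
  by (simp add: dvd_mod_iff q_def le_imp_power_dvd del: power_Suc)

lemma sum_multiples:
  assumes "j \<le> Suc s"
  shows "(\<Sum>x\<in>{0..<q}. of_bool (p ^ j dvd x)) = P ^ (Suc s - j)"
proof -
  have qq: "q = p ^ j * p ^ (Suc s - j)"
    using assms by (simp add: q_def flip: power_add)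
  have pj: "p ^ j > 0" using p_gt_1 by simp
  have eq: "{x \<in> {0..<q}. p ^ j dvd x} = (*) (p ^ j) ` {0..<p ^ (Suc s - j)}"
  proof (intro equalityI subsetI)
    fix x assume "x \<in> {x \<in> {0..<q}. p ^ j dvd x}"
    then obtain y where "x = p ^ j * y" "0 \<le> p ^ j * y" "p ^ j * y < p ^ j * p ^ (Suc s - j)"
      by (auto simp: qq)
    then show "x \<in> (*) (p ^ j) ` {0..<p ^ (Suc s - j)}"
      using pj by (auto simp: zero_le_mult_iff mult_less_cancel_left_pos)
  qed (use pj in \<open>auto simp: qq\<close>)
  have "(\<Sum>x\<in>{0..<q}. of_bool (p ^ j dvd x) :: rat) = of_nat (card {x \<in> {0..<q}. p ^ j dvd x})"
    by (simp add: of_bool_def sum.If_cases Int_def)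
  also have "card {x \<in> {0..<q}. p ^ j dvd x} = nat (p ^ (Suc s - j))"
    unfolding eq using p_gt_1 by (subst card_image) (auto simp: inj_on_def)
  also have "of_nat (nat (p ^ (Suc s - j))) = P ^ (Suc s - j)"
    using p_gt_1 by (simp add: P_def)
  finally show ?thesis .
qed

lemma sum_units: "(\<Sum>x\<in>{0..<q}. of_bool (\<not> p dvd x)) = phi"
proof -
  have "(\<Sum>x\<in>{0..<q}. of_bool (\<not> p dvd x) :: rat) = (\<Sum>x\<in>{0..<q}. 1 - of_bool (p ^ 1 dvd x))"
    by (intro sum.cong) auto
  also have "\<dots> = of_int q - P ^ s"
    using sum_multiples[of 1] q_pos by (simp add: sum_subtractf flip: of_int_q)
  finally show ?thesis by (simp add: phi_def of_int_q algebra_simps)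
qed

section \<open>Recursion for walks that start from a unit\<close>

definition S :: "nat \<Rightarrow> int \<Rightarrow> rat" where
  "S m b = (\<Sum>x\<in>{0..<q}. walks q m b x)"

definition tot :: "nat \<Rightarrow> rat" where
  "tot m = (\<Sum>b\<in>{0..<q}. of_bool (\<not> p dvd b) * S m b)"

text \<open>The operator K of the overview: \<open>x\<close> is the nonunit passed through, and
  \<open>c\<close> is the coefficient of the step from \<open>(b, x)\<close> to
  \<open>(x, c * x - b)\<close>.\<close>

definition transfer :: "(int \<Rightarrow> rat) \<Rightarrow> int \<Rightarrow> rat" where
  "transfer F b = (\<Sum>x\<in>{0..<q}. of_bool (p dvd x) * (\<Sum>c\<in>{0..<q}. F (c * x - b)))"

lemma S_mod: "S m (b mod q) = S m b"
  unfolding S_def by (intro sum.cong walks_cong refl) (auto simp: cong_def)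

lemma walks_mod: "walks q m a (b mod q) = walks q m a b"
  by (rule walks_cong) (auto simp: cong_def)

text \<open>A unit \<open>b\<close> makes \<open>c * b - a\<close> run through every residue exactly
  once, so the step forgets \<open>a\<close>.\<close>

lemma walks_Suc_unit:
  assumes "\<not> p dvd b"
  shows "walks q (Suc m) a b = S m b"
  using sum_residues_affine[OF q_pos coprime_q[OF assms], of "walks q m b" "- a"]
  by (simp add: walks_mod S_def mult.commute)

text \<open>Every \<open>c * b - a\<close> is a unit here, so the second step forgets
  \<open>b\<close>.\<close>

lemma walks_Suc_Suc_nonunit:
  assumes "p dvd b" "\<not> p dvd a"
  shows "walks q (Suc (Suc m)) a b = (\<Sum>c\<in>{0..<q}. S m (c * b - a))"
proof -
  have "\<not> p dvd c * b - a" for c using assms by (simp add: dvd_diff_right_iff)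
  then have "walks q (Suc m) b (c * b - a) = S m (c * b - a)" for c
    by (rule walks_Suc_unit)
  then show ?thesis by (subst walks.simps) simp
qed

lemma S_0: "S 0 b = of_bool ([b = 1] (mod q))"
proof -
  have "S 0 b = (\<Sum>x\<in>{0..<q}. if x = 0 then of_bool ([b = 1] (mod q)) else 0)"
    unfolding S_def by (intro sum.cong) (auto simp: cong_def)
  also have "\<dots> = of_bool ([b = 1] (mod q))" using q_pos by (subst sum.delta) auto
  finally show ?thesis .
qed

lemma q_gt_1: "q > 1"
  using p_gt_1 by (simp add: q_def one_less_power del: power_Suc)

lemma tot_0: "tot 0 = 1"
proof -
  have "tot 0 = (\<Sum>x\<in>{0..<q}. if x = 1 then 1 else 0)"
    unfolding tot_def S_0 using p_gt_1 q_gt_1 by (intro sum.cong) (auto simp: cong_def)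
  also have "\<dots> = 1" using q_gt_1 by (subst sum.delta) auto
  finally show ?thesis .
qed

lemma S_1: 
  assumes "\<not> p dvd b"
  shows "S 1 b = 1"
proof -
  \<comment> \<open>A walk of length 1 ends with first coordinate \<open>x\<close>, which must be
    congruent to 1; nonunits therefore contribute nothing.\<close>
  have "walks q 1 b x = of_bool (\<not> p dvd x) * S 0 x" for x
  proof (cases "p dvd x")
    case True
    then have "\<not> [x = 1] (mod q)"
      using p_dvd_q p_gt_1 by (metis cong_dvd_iff cong_dvd_modulus zdvd_not_zless zero_less_one)
    then show ?thesis using True by simp
  next
    case False
    then show ?thesis using walks_Suc_unit[of x 0 b] by simp
  qed
  then have "S 1 b = tot 0" by (simp add: S_def tot_def)
  then show ?thesis by (simp add: tot_0)
qed

lemma tot_1: "tot 1 = phi"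
proof -
  have "of_bool (\<not> p dvd b) * S 1 b = of_bool (\<not> p dvd b)" for b
    using S_1 by (cases "p dvd b") auto
  then show ?thesis unfolding tot_def sum_units[symmetric] by (intro sum.cong) auto
qed

text \<open>The second coordinate \<open>x\<close> is either a unit, and then \<open>b\<close> is
  forgotten at once, or a nonunit, and then \<open>b\<close> survives one more step.\<close>

lemma S_rec:
  assumes "\<not> p dvd b"
  shows "S (Suc (Suc m)) b = tot (Suc m) + transfer (S m) b"
proof -
  have "walks q (Suc (Suc m)) b x = of_bool (\<not> p dvd x) * S (Suc m) x
     + of_bool (p dvd x) * (\<Sum>c\<in>{0..<q}. S m (c * x - b))" for x
    using walks_Suc_unit[of x "Suc m" b] walks_Suc_Suc_nonunit[OF _ assms, of x m]
    by (cases "p dvd x") (simp_all del: walks.simps)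
  then show ?thesis
    unfolding S_def[of "Suc (Suc m)"] tot_def transfer_def sum.distrib[symmetric]
    by (intro sum.cong refl)
qed

lemma transfer_add: "transfer (\<lambda>b. F b + G b) b = transfer F b + transfer G b"
  by (simp add: transfer_def sum.distrib algebra_simps)

lemma transfer_sum: "transfer (\<lambda>b. \<Sum>i\<in>I. a i * F i b) b = (\<Sum>i\<in>I. a i * transfer (F i) b)"
proof -
  have "transfer (\<lambda>b. \<Sum>i\<in>I. a i * F i b) b
     = (\<Sum>x\<in>{0..<q}. \<Sum>i\<in>I. a i * (of_bool (p dvd x) * (\<Sum>c\<in>{0..<q}. F i (c * x - b))))"
    unfolding transfer_def
    by (intro sum.cong refl, subst sum.swap) (simp add: sum_distrib_left mult_ac)
  also have "\<dots> = (\<Sum>i\<in>I. a i * transfer (F i) b)"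
    unfolding transfer_def by (subst sum.swap) (simp add: sum_distrib_left)
  finally show ?thesis .
qed

text \<open>For nonunit \<open>x\<close> and unit \<open>b\<close> every \<open>c * x - b\<close> is
  a unit, so \<open>transfer\<close> at a unit sees its argument only on units.\<close>

lemma transfer_cong:
  assumes "\<not> p dvd b" and "\<And>b. \<not> p dvd b \<Longrightarrow> F b = G b"
  shows "transfer F b = transfer G b"
proof -
  have "F (c * x - b) = G (c * x - b)" if "p dvd x" for c x
    using that assms by (simp add: dvd_diff_right_iff)
  then show ?thesis unfolding transfer_def by (intro sum.cong) auto
qed

lemma transfer_const: "transfer (\<lambda>_. a) b = P ^ (2 * s + 1) * a"
proof -
  have "transfer (\<lambda>_. a) b = (\<Sum>x\<in>{0..<q}. of_bool (p ^ 1 dvd x)) * (of_int q * a)"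
    using q_pos unfolding transfer_def by (simp only: sum_distrib_right) simp
  also have "\<dots> = P ^ s * (of_int q * a)" by (subst sum_multiples) auto
  finally show ?thesis by (simp add: of_int_q power_add mult_2)
qed

lemma tot_rec: "tot (Suc (Suc m)) = phi * tot (Suc m) + P ^ (2 * s + 1) * tot m"
proof -
  \<comment> \<open>Cutting \<open>S m\<close> off outside the units allows sums over all residues,
    which are invariant under translation.\<close>
  define F where "F b = of_bool (\<not> p dvd b) * S m b" for b
  have Fmod: "F (b mod q) = F b" for b
    using dvd_mod_q[of 1 b] by (simp add: F_def S_mod)
  have sumF: "(\<Sum>b\<in>{0..<q}. F (y - b)) = tot m" for y
    using sum_residues_affine[OF q_pos, of "-1" F y] Fmod by (simp add: tot_def F_def)
  have eq: "of_bool (\<not> p dvd b) * S (Suc (Suc m)) b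
     = of_bool (\<not> p dvd b) * tot (Suc m) + transfer F b" for b
  proof (cases "p dvd b")
    case True
    then have "of_bool (p dvd x) * (\<Sum>c\<in>{0..<q}. F (c * x - b)) = 0" for x
      by (auto simp: F_def)
    then show ?thesis using True by (simp add: transfer_def)
  next
    case False
    then show ?thesis
      using S_rec transfer_cong[OF False, of "S m" F] by (simp add: F_def)
  qed
  \<comment> \<open>Summed over \<open>b\<close>, the shift by \<open>c * x\<close> disappears, and
    \<open>F\<close> may be replaced by its total.\<close>
  have "(\<Sum>b\<in>{0..<q}. transfer F b) = transfer (\<lambda>_. \<Sum>b\<in>{0..<q}. F b) 0"
  proof -
    have "(\<Sum>b\<in>{0..<q}. transfer F b)
      = (\<Sum>x\<in>{0..<q}. of_bool (p dvd x) * (\<Sum>c\<in>{0..<q}. \<Sum>b\<in>{0..<q}. F (c * x - b)))"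
      unfolding transfer_def
      by (subst sum.swap, intro sum.cong refl, simp only: sum_distrib_left[symmetric])
         (subst sum.swap, rule refl)
    also have "\<dots> = transfer (\<lambda>_. \<Sum>b\<in>{0..<q}. F b) 0"
      by (simp add: sumF transfer_def) (simp add: tot_def F_def)
    finally show ?thesis .
  qed
  also have "\<dots> = P ^ (2 * s + 1) * tot m" by (simp only: transfer_const) (simp add: tot_def F_def)
  finally have *: "(\<Sum>b\<in>{0..<q}. transfer F b) = P ^ (2 * s + 1) * tot m" .
  have "tot (Suc (Suc m)) = (\<Sum>b\<in>{0..<q}. of_bool (\<not> p dvd b) * tot (Suc m) + transfer F b)"
    unfolding tot_def[of "Suc (Suc m)"] eq ..
  also have "\<dots> = phi * tot (Suc m) + P ^ (2 * s + 1) * tot m"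
    by (simp only: sum.distrib * sum_distrib_right[symmetric] sum_units)
  finally show ?thesis .
qed

text \<open>The characteristic polynomial of \<open>tot_rec\<close> has the roots
  \<open>P ^ Suc s\<close> and \<open>- (P ^ s)\<close>; the factor \<open>P + 1\<close> is their
  difference divided by \<open>P ^ s\<close>.\<close>

lemma tot_closed: "tot m * (P + 1) = P ^ (s * m) * (P ^ (m + 1) + (-1) ^ m)"
proof (induction m rule: induct_nat_012)
  case 0 show ?case by (simp add: tot_0)
next
  case 1 show ?case unfolding One_nat_def[symmetric] tot_1
    by (simp add: phi_def algebra_simps power2_eq_square)
next
  case (ge2 m)
  have "tot (Suc (Suc m)) * (P + 1)
     = phi * (tot (Suc m) * (P + 1)) + P ^ (2 * s + 1) * (tot m * (P + 1))"
    by (simp add: tot_rec algebra_simps)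
  also have "\<dots> = P ^ (s * Suc (Suc m)) * (P ^ (Suc (Suc m) + 1) + (-1) ^ Suc (Suc m))"
    unfolding ge2 by (simp add: phi_def algebra_simps power_add mult_2_right)
  finally show ?case .
qed

text \<open>As \<open>u\<close> is a unit, exactly one of the \<open>p\<close> shifts of a multiple
  of \<open>p ^ j\<close> is divisible by \<open>p ^ Suc j\<close>; a nonmultiple has no such
  shift.\<close>

lemma sum_of_bool_dvd_shift:
  assumes "\<not> p dvd u"
  shows "(\<Sum>t\<in>{0..<p}. of_bool (p ^ Suc j dvd y + t * p ^ j * u) :: rat) = of_bool (p ^ j dvd y)"
proof (cases "p ^ j dvd y")
  case True
  then obtain z where z: "y = p ^ j * z" by blast
  have "y + t * p ^ j * u = p ^ j * (u * t + z)" for t by (simp add: z algebra_simps)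
  then have "p ^ Suc j dvd y + t * p ^ j * u \<longleftrightarrow> p dvd u * t + z" for t
    using p_gt_1 by (simp add: mult.commute[of p])
  then have "(\<Sum>t\<in>{0..<p}. of_bool (p ^ Suc j dvd y + t * p ^ j * u) :: rat)
    = (\<Sum>t\<in>{0..<p}. of_bool (p dvd u * t + z))" by simp
  also have "\<dots> = (\<Sum>t\<in>{0..<p}. of_bool (p dvd t))"
    using p_gt_1 assms prime_p
    by (intro sum_residues_affine) (auto simp: prime_imp_coprime coprime_commute dvd_mod_iff)
  also have "\<dots> = (\<Sum>t\<in>{0..<p}. if t = 0 then 1 else 0)"
    by (intro sum.cong) (auto dest: zdvd_imp_le)
  also have "\<dots> = 1" using p_gt_1 by (subst sum.delta) auto
  finally show ?thesis using True by simp
next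
  case False
  have "\<not> p ^ Suc j dvd y + t * p ^ j * u" for t
  proof
    assume "p ^ Suc j dvd y + t * p ^ j * u"
    then have "p ^ j dvd y + t * p ^ j * u" 
      by (metis dvd_trans le_SucI le_refl le_imp_power_dvd)
    then show False using False by (simp add: dvd_add_left_iff)
  qed
  then show ?thesis using False by simp
qed

text \<open>If \<open>x = p\<^sup>i u\<close> with \<open>i \<le> j\<close> and \<open>u\<close> a unit, then shifting \<open>c\<close> by multiples of \<open>p\<^sup>j\<^sup>-\<^sup>i\<close> distributes the
  solutions modulo \<open>p\<^sup>j\<close> evenly over the \<open>p\<close> lifts of \<open>t\<close> modulo \<open>p\<^sup>j\<^sup>+\<^sup>1\<close>.\<close>

lemma sum_of_bool_dvd_descend:
  assumes j: "j \<le> s" and x: "\<not> p ^ Suc j dvd x"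
  shows "P * (\<Sum>c\<in>{0..<q}. of_bool (p ^ Suc j dvd c * x - t)) = (\<Sum>c\<in>{0..<q}. of_bool (p ^ j dvd c * x - t))"
proof -
  have x0: "x \<noteq> 0" using x by auto
  obtain u where u: "x = p ^ multiplicity p x * u" "\<not> p dvd u"
    using multiplicity_decompose'[of x p] x0 prime_p
    by (metis not_prime_unit)
  define i where "i = multiplicity p x"
  have i: "i \<le> j" using x u(1) unfolding i_def
    by (metis dvd_triv_left dvd_trans le_imp_power_dvd not_less_eq_eq)
  \<comment> \<open>Since \<open>x = p ^ i * u\<close>, moving \<open>c\<close> by
    \<open>v * p ^ (j - i)\<close> moves \<open>c * x\<close> by \<open>v * p ^ j * u\<close>, the
    shift of \<open>sum_of_bool_dvd_shift\<close>.\<close>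
  have e: "(c + v * p ^ (j - i)) * x - t = (c * x - t) + v * p ^ j * u" for c v
  proof -
    have "p ^ (j - i) * x = p ^ j * u"
      using i by (subst u(1)) (simp add: i_def mult.assoc[symmetric] power_add[symmetric])
    then show ?thesis by (simp add: algebra_simps)
  qed
  have "(\<Sum>c\<in>{0..<q}. of_bool (p ^ j dvd c * x - t) :: rat)
     = (\<Sum>c\<in>{0..<q}. \<Sum>v\<in>{0..<p}. of_bool (p ^ Suc j dvd (c + v * p ^ (j - i)) * x - t))"
    unfolding e by (simp only: sum_of_bool_dvd_shift[OF u(2)])
  also have "\<dots> = (\<Sum>v\<in>{0..<p}. \<Sum>c\<in>{0..<q}. of_bool (p ^ Suc j dvd (c + v * p ^ (j - i)) * x - t))"
    by (rule sum.swap)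
  \<comment> \<open>Translating \<open>c\<close> permutes the residues modulo \<open>q\<close>, so
    the \<open>p\<close> inner sums agree.\<close>
  also have "\<dots> = (\<Sum>v\<in>{0..<p}. \<Sum>c\<in>{0..<q}. of_bool (p ^ Suc j dvd c * x - t))"
  proof (rule sum.cong[OF refl])
    fix v
    define g where "g c = (of_bool (p ^ Suc j dvd c * x - t) :: rat)" for c
    have "g (c mod q) = g c" for c
    proof -
      have "p ^ Suc j dvd q" using j unfolding q_def by (intro le_imp_power_dvd) auto
      then have "[(c mod q) * x - t = c * x - t] (mod p ^ Suc j)"
        by (intro cong_diff cong_mult cong_refl) (metis cong_def mod_mod_cancel)
      then show ?thesis by (simp add: g_def cong_dvd_iff del: power_Suc add: cong_0_iff[symmetric]) 
         (metis cong_sym cong_trans)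
    qed
    then have "(\<Sum>c\<in>{0..<q}. g (1 * c + v * p ^ (j - i))) = (\<Sum>c\<in>{0..<q}. g c)"
      by (intro sum_residues_affine q_pos) auto
    then show "(\<Sum>c\<in>{0..<q}. of_bool (p ^ Suc j dvd (c + v * p ^ (j - i)) * x - t) :: rat)
       = (\<Sum>c\<in>{0..<q}. of_bool (p ^ Suc j dvd c * x - t))"
      by (simp add: g_def del: power_Suc)
  qed
  also have "\<dots> = P * (\<Sum>c\<in>{0..<q}. of_bool (p ^ Suc j dvd c * x - t))"
    using p_gt_1 by (simp add: P_def del: power_Suc)
  finally show ?thesis ..
qed

text \<open>\<open>avg j e\<close> is the indicator function of \<open>e\<close> on the units modulo \<open>q\<close>, averaged over the classes
  modulo \<open>p\<^sup>j\<close>; there are \<open>phi\<close> units in the only class for \<open>j = 0\<close>, hence the separate case.\<close>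

definition avg :: "nat \<Rightarrow> int \<Rightarrow> int \<Rightarrow> rat" where
  "avg j e b = (if j = 0 then 1 / phi else of_bool (p ^ j dvd b - e) * P ^ j / P ^ Suc s)"

text \<open>For \<open>j \<le> s\<close> this is the component of level \<open>j + 1\<close> in the
  overview: it depends only on the class modulo \<open>p ^ Suc j\<close> and, for a unit
  \<open>e\<close>, has mean zero over the units in each class modulo \<open>p ^ j\<close>.\<close>

definition eig :: "nat \<Rightarrow> int \<Rightarrow> int \<Rightarrow> rat" where
  "eig j e b = avg (Suc j) e b - avg j e b"

text \<open>Modulo \<open>p ^ j\<close> the product \<open>c * x\<close> vanishes, and
  \<open>- b\<close> lies in the class of \<open>e\<close> exactly if \<open>b\<close> lies in that
  of \<open>- e\<close>.\<close>

lemma avg_shift: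
  assumes "p ^ j dvd x"
  shows "avg j e (c * x - b) = avg j (- e) b"
proof -
  have "p ^ j dvd c * x - b - e \<longleftrightarrow> p ^ j dvd c * x - (b + e)" by (simp add: algebra_simps)
  also have "\<dots> \<longleftrightarrow> p ^ j dvd b + e" using assms by (simp add: dvd_diff_right_iff)
  finally show ?thesis by (simp add: avg_def)
qed

text \<open>Only the \<open>P ^ (s - j)\<close> multiples \<open>x\<close> of
  \<open>p ^ Suc j\<close> contribute, with \<open>q\<close> equal terms each; for the other
  nonunits \<open>x\<close> the two averages in \<open>eig\<close> cancel after summation over
  \<open>c\<close>.\<close>

lemma transfer_eig:
  assumes j: "j \<le> s"
  shows "transfer (eig j e) b = P ^ (2 * s + 1 - j) * eig j (- e) b"
proof -
  have "of_bool (p dvd x) * (\<Sum>c\<in>{0..<q}. eig j e (c * x - b))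
      = of_bool (p ^ Suc j dvd x) * (P ^ Suc s * eig j (- e) b)" for x
  proof (cases "p ^ Suc j dvd x")
    case True
    then have 1: "p ^ j dvd x" and 2: "p dvd x" by (auto elim: dvd_mult_left dvd_mult_right)
    have "eig j e (c * x - b) = eig j (- e) b" for c
      unfolding eig_def using avg_shift[OF True] avg_shift[OF 1] by simp
    then show ?thesis using True 2 q_pos by (simp add: of_int_q[symmetric] del: power_Suc)
  next
    case False
    show ?thesis
    proof (cases j)
      \<comment> \<open>Here \<open>x\<close> is a unit, which \<open>transfer\<close> leaves
        out.\<close>
      case 0
      then show ?thesis using False by simp
    next
      case (Suc i)
      have *: "c * x - b - e = c * x - (b + e)" for c by simp
      have "(\<Sum>c\<in>{0..<q}. eig j e (c * x - b))
         = (P * (\<Sum>c\<in>{0..<q}. of_bool (p ^ Suc j dvd c * x - (b + e)))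
           - (\<Sum>c\<in>{0..<q}. of_bool (p ^ j dvd c * x - (b + e)))) * (P ^ j / P ^ Suc s)"
        unfolding eig_def avg_def * sum_distrib_left left_diff_distrib sum_distrib_right
          sum_subtractf[symmetric]
        using Suc by (intro sum.cong) (simp_all add: field_simps)
      also have "\<dots> = 0" using sum_of_bool_dvd_descend[OF j False] by simp
      finally show ?thesis using False by simp
    qed
  qed
  then have "transfer (eig j e) b = (\<Sum>x\<in>{0..<q}. of_bool (p ^ Suc j dvd x)) * (P ^ Suc s * eig j (- e) b)"
    unfolding transfer_def by (simp only: sum_distrib_right)
  also have "\<dots> = P ^ (s - j) * (P ^ Suc s * eig j (- e) b)"
    using j by (subst sum_multiples) auto
  also have "\<dots> = P ^ (2 * s + 1 - j) * eig j (- e) b"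
  proof -
    have "s - j + Suc s = 2 * s + 1 - j" using j by simp
    then show ?thesis by (metis mult.assoc power_add)
  qed
  finally show ?thesis .
qed

text \<open>\<open>S 1\<close> is constant on the units and the double step of \<open>S_rec\<close>
  preserves this, so each value equals the mean over the \<open>phi\<close> units.\<close>

lemma S_odd: "\<not> p dvd b \<Longrightarrow> S (2 * i + 1) b = tot (2 * i + 1) / phi"
proof (induction i arbitrary: b)
  case 0
  then show ?case using S_1 tot_1 phi_pos by simp
next
  case (Suc i)
  have "S (2 * Suc i + 1) b = tot (2 * i + 2) + transfer (S (2 * i + 1)) b"
    using S_rec[OF Suc.prems, of "2 * i + 1"] by simp
  also have "transfer (S (2 * i + 1)) b = transfer (\<lambda>_. tot (2 * i + 1) / phi) b"
    by (rule transfer_cong[OF Suc.prems Suc.IH])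
  also have "\<dots> = P ^ (2 * s + 1) * (tot (2 * i + 1) / phi)" by (rule transfer_const)
  also have "tot (2 * i + 2) + \<dots> = tot (2 * Suc i + 1) / phi"
    using tot_rec[of "2 * i + 1"] phi_pos by (simp add: field_simps)
  finally show ?case .
qed

text \<open>\<open>S 0\<close>, the indicator function of 1, is its mean plus a telescoping sum of
  the \<open>eig j 1\<close>. Each double step of \<open>S_rec\<close> turns the mean into the next
  one, multiplies every other component by its eigenvalue and flips the sign of its centre.\<close>

lemma S_even:
  "\<not> p dvd b \<Longrightarrow> S (2 * i) b
     = tot (2 * i) / phi + (\<Sum>j\<le>s. (P ^ (2 * s + 1 - j)) ^ i * eig j ((-1) ^ i) b)"
proof (induction i arbitrary: b)
  case 0
  have "(\<Sum>j\<le>s. eig j 1 b) = avg (Suc s) 1 b - avg 0 1 b"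
    unfolding eig_def by (rule sum_telescope[of "\<lambda>j. - avg j 1 b", simplified])
  also have "\<dots> = S 0 b - 1 / phi"
    using P_pos by (simp add: avg_def S_0 cong_iff_dvd_diff q_def)
  finally show ?case by (simp add: tot_0)
next
  case (Suc i)
  define T where "T b = (\<Sum>j\<le>s. (P ^ (2 * s + 1 - j)) ^ i * eig j ((-1) ^ i) b)" for b
  have "S (2 * Suc i) b = tot (2 * i + 1) + transfer (S (2 * i)) b"
    using S_rec[OF Suc.prems, of "2 * i"] by simp
  also have "transfer (S (2 * i)) b = transfer (\<lambda>b. tot (2 * i) / phi + T b) b"
    unfolding T_def by (rule transfer_cong[OF Suc.prems Suc.IH])
  also have "\<dots> = P ^ (2 * s + 1) * (tot (2 * i) / phi) + transfer T b"
    by (simp only: transfer_add transfer_const)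
  also have "transfer T b = (\<Sum>j\<le>s. (P ^ (2 * s + 1 - j)) ^ i * transfer (eig j ((-1) ^ i)) b)"
    unfolding T_def by (rule transfer_sum)
  also have "\<dots> = (\<Sum>j\<le>s. (P ^ (2 * s + 1 - j)) ^ Suc i * eig j ((-1) ^ Suc i) b)"
    by (intro sum.cong) (auto simp: transfer_eig)
  also have "tot (2 * i + 1) + (P ^ (2 * s + 1) * (tot (2 * i) / phi) + \<dots>)
     = tot (2 * Suc i) / phi + \<dots>"
    using tot_rec[of "2 * i"] phi_pos by (simp add: field_simps)
  finally show ?case .
qed

section \<open>Closed forms, with \<open>k = Suc i\<close> in the notation of
  \<open>Phi\<close>\<close>

lemma tot_odd_closed: "tot (2 * i + 1) / phi = P ^ (s * (2 * i)) * gauss_int (Suc i) (P ^ 2)"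
proof -
  have P: "P + 1 \<noteq> 0" "P ^ 2 - 1 \<noteq> 0" using P_gt_1 by (auto simp: power2_eq_1_iff)
  have "(P ^ 2 - 1) * gauss_int (Suc i) (P ^ 2) = (P ^ 2) ^ Suc i - 1"
    unfolding gauss_int_def by (rule power_diff_1_eq[symmetric])
  then have g: "(P + 1) * (P - 1) * gauss_int (Suc i) (P ^ 2) = P ^ (2 * i + 2) - 1"
    by (simp add: power_mult[symmetric] algebra_simps power2_eq_square power_add)
       (simp add: power_mult power2_eq_square power_mult_distrib mult.commute[of i])
  have "(P + 1) * tot (2 * i + 1) = P ^ (s * (2 * i + 1)) * (P ^ (2 * i + 2) - 1)"
    using tot_closed[of "2 * i + 1"] by (simp add: mult.commute)
  also have "\<dots> = (P + 1) * (P ^ (s * (2 * i)) * gauss_int (Suc i) (P ^ 2) * phi)"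
    unfolding g[symmetric] phi_def by (simp add: algebra_simps power_add)
  finally have "tot (2 * i + 1) = P ^ (s * (2 * i)) * gauss_int (Suc i) (P ^ 2) * phi"
    using P(1) by (simp only: mult_left_cancel not_False_eq_True)
  then show ?thesis using phi_pos by simp
qed

text \<open>The subtracted term comes from the constant \<open>- 1 / phi\<close> in
  \<open>eig 0\<close>; taken together with the mean it yields the Gaussian binomial.\<close>

lemma tot_even_closed:
  "tot (2 * i) / phi - P ^ ((2 * s + 1) * i) / phi
     = P ^ (2 * s * i) / P ^ s * ((P - 1) * gauss_binomial2 (Suc i) P)"
proof -
  have P: "P + 1 \<noteq> 0" "P - 1 \<noteq> 0" "P ^ s \<noteq> 0" using P_gt_1 by auto
  have t: "tot (2 * i) = P ^ (2 * s * i) * (P ^ (2 * i + 1) + 1) / (P + 1)"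
    using tot_closed[of "2 * i"] P by (simp add: field_simps)
  have P2: "P ^ 2 - 1 = (P - 1) * (P + 1)" by (simp add: power2_eq_square algebra_simps)
  have g: "(P - 1) * gauss_binomial2 (Suc i) P = (P * P ^ i - 1) * (P ^ i - 1) / ((P - 1) * (P + 1))"
    unfolding gauss_binomial2_def P2 using P by simp
  have pw1: "P ^ ((2 * s + 1) * i) = P ^ (2 * s * i) * P ^ i" by (simp add: algebra_simps power_add)
  have pw2: "P ^ (2 * i + 1) = P * (P ^ i * P ^ i)" by (simp add: power_add mult_2)
  have "X * (P * (Y * Y) + 1) / (P + 1) / (Z * (P - 1)) - X * Y / (Z * (P - 1))
      = X / Z * ((P * Y - 1) * (Y - 1) / ((P - 1) * (P + 1)))" if "Z \<noteq> 0" for X Y Z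
    using P(1,2) that by (simp add: divide_simps) (simp add: algebra_simps)
  from this[OF P(3)] show ?thesis
    unfolding g t phi_def pw1 pw2 .
qed

text \<open>Serves to decide when 1 lies in the class of -1 modulo \<open>p ^ Suc j\<close>.\<close>

lemma not_power_dvd_2: "\<not> p ^ Suc j dvd 2" if "p \<noteq> 2 \<or> j > 0"
proof
  assume d: "p ^ Suc j dvd 2"
  then have "p dvd 2" by (metis dvd_trans dvd_triv_left power_Suc)
  then have p2: "p = 2" using p_gt_1 zdvd_imp_le[of p 2] by auto
  with that obtain i where "j = Suc i" by (cases j) auto
  with d p2 have "(2::int) * (2 * 2 ^ i) dvd 2" by simp
  then have "(2::int) * 2 ^ i dvd 1" by (metis dvd_mult_cancel_left mult.right_neutral zero_neq_numeral)
  then show False by (meson dvd_mult_left odd_one)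
qed

text \<open>An odd \<open>i\<close> centres the averages at -1, while the evaluation is at 1. For
  odd \<open>p\<close> only the constant in \<open>eig 0\<close> survives; for \<open>p = 2\<close>
  the levels 0 and 1 matter, and level 1 occurs only for \<open>s > 0\<close>.\<close>

lemma sum_eig_odd:
  assumes "odd i"
  shows "(\<Sum>j\<le>s. (P ^ (2 * s + 1 - j)) ^ i * eig j ((-1) ^ i) 1)
    = - (P ^ ((2 * s + 1) * i) / phi)
      + (if p \<noteq> 2 then 0 else if s = 0 then P ^ i else P ^ (2 * s * i) / P ^ s * (P ^ i - 1))"
proof -
  have a0: "avg 0 (-1) 1 = 1 / phi" by (simp add: avg_def)
  have a: "avg (Suc j) (-1) 1 = (if p \<noteq> 2 \<or> j > 0 then 0 else 1 / P ^ s)" for j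
    using not_power_dvd_2[of j] P_pos by (auto simp: avg_def)
  have e: "(-1) ^ i = (-1 :: int)" using assms by simp
  have eig0: "eig 0 (-1) 1 = (if p \<noteq> 2 then 0 else 1 / P ^ s) - 1 / phi"
    by (simp add: eig_def a a0)
  have eig1: "eig (Suc 0) (-1) 1 = (if p \<noteq> 2 then 0 else - 1 / P ^ s)"
    by (simp add: eig_def a)
  have eig2: "eig (Suc (Suc j)) (-1) 1 = 0" for j
    by (simp add: eig_def a)
  have pw: "P ^ ((2 * s + 1) * i) = P ^ (2 * s * i) * P ^ i" by (simp add: algebra_simps power_add)
  show ?thesis
  proof (cases "s = 0")
    case 0: True
    have "(\<Sum>j\<le>s. (P ^ (2 * s + 1 - j)) ^ i * eig j (-1) 1) = P ^ i * eig 0 (-1) 1"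
      using 0 by simp
    also have "\<dots> = - (P ^ ((2 * s + 1) * i) / phi) + (if p \<noteq> 2 then 0 else P ^ i)"
      unfolding eig0 using 0 by (simp add: algebra_simps)
    finally show ?thesis unfolding e using 0 by simp
  next
    case False
    have "(\<Sum>j\<le>s. (P ^ (2 * s + 1 - j)) ^ i * eig j (-1) 1)
      = (P ^ (2 * s + 1)) ^ i * eig 0 (-1) 1 + (P ^ (2 * s)) ^ i * eig (Suc 0) (-1) 1"
    proof -
      have "(\<Sum>j\<le>s. (P ^ (2 * s + 1 - j)) ^ i * eig j (-1) 1)
        = (\<Sum>j\<in>{0, Suc 0}. (P ^ (2 * s + 1 - j)) ^ i * eig j (-1) 1)"
      proof (rule sum.mono_neutral_right)
        show "\<forall>j\<in>{..s} - {0, Suc 0}. (P ^ (2 * s + 1 - j)) ^ i * eig j (-1) 1 = 0"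
        proof
          fix j assume "j \<in> {..s} - {0, Suc 0}"
          then obtain l where "j = Suc (Suc l)" by (cases j; cases "j - 1") auto
          then show "(P ^ (2 * s + 1 - j)) ^ i * eig j (-1) 1 = 0" by (simp add: eig2)
        qed
      qed (use False in auto)
      then show ?thesis by simp
    qed
    then show ?thesis
      unfolding e power_mult[symmetric] pw eig0 eig1 using False
      by (simp add: algebra_simps diff_divide_distrib)
  qed
qed

text \<open>The averages are centred at the evaluation point, so every level contributes. The levels
  above 0 form a geometric series whose ratio \<open>P powi (1 - int i)\<close> is the base of
  \<open>gauss_int\<close> in \<open>Phi\<close>.\<close>

lemma sum_eig_even:
  assumes "even i"
  shows "(\<Sum>j\<le>s. (P ^ (2 * s + 1 - j)) ^ i * eig j ((-1) ^ i) 1)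
    = - (P ^ ((2 * s + 1) * i) / phi)
      + P ^ (2 * s * i) / P ^ s * ((P - 1) * gauss_int s (P powi (1 - int i)) + P ^ i)"
proof -
  have a0: "avg 0 1 1 = 1 / phi" by (simp add: avg_def)
  have a: "avg (Suc j) 1 1 = P ^ j / P ^ s" for j
    using P_pos by (simp add: avg_def)
  have e: "(-1) ^ i = (1 :: int)" using assms by simp
  \<comment> \<open>Here \<open>w\<close> stands for \<open>j - 1\<close>. Both sides are compared
    after multiplication by \<open>(P ^ w) ^ i\<close>, which removes the negative
    exponents.\<close>
  have summand: "(P ^ (2 * s - w)) ^ i * eig (Suc w) 1 1
     = P ^ (2 * s * i) / P ^ s * ((P - 1) * (P powi (1 - int i)) ^ w)" if "w < s" for w
  proof -
    have 1: "(P ^ (2 * s - w)) ^ i * (P ^ w) ^ i = P ^ (2 * s * i)"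
      using that by (simp add: power_mult_distrib[symmetric] power_add[symmetric] power_mult)
    have 2: "(P powi (1 - int i)) ^ w * (P ^ w) ^ i = P ^ w"
    proof -
      have "P powi (1 - int i) * P ^ i = P"
        using P_pos by (simp add: power_int_diff)
      then show ?thesis by (metis power_commutes power_mult power_mult_distrib mult.commute)
    qed
    have "(P ^ (2 * s - w)) ^ i * eig (Suc w) 1 1 * (P ^ w) ^ i
      = P ^ (2 * s * i) / P ^ s * ((P - 1) * P ^ w)"
      unfolding 1[symmetric] using P_pos by (simp add: eig_def a field_simps)
    also have "\<dots> = P ^ (2 * s * i) / P ^ s * ((P - 1) * (P powi (1 - int i)) ^ w) * (P ^ w) ^ i"
      by (subst 2[symmetric]) simp
    finally show ?thesis using P_pos by (simp only: mult_right_cancel power_not_zero less_imp_neq[symmetric] not_False_eq_True)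
  qed
  have "(\<Sum>j\<le>s. (P ^ (2 * s + 1 - j)) ^ i * eig j 1 1)
    = (P ^ (2 * s + 1)) ^ i * eig 0 1 1 + (\<Sum>w<s. (P ^ (2 * s - w)) ^ i * eig (Suc w) 1 1)"
    by (simp add: sum.atMost_shift)
  also have "(\<Sum>w<s. (P ^ (2 * s - w)) ^ i * eig (Suc w) 1 1)
    = (\<Sum>w<s. P ^ (2 * s * i) / P ^ s * ((P - 1) * (P powi (1 - int i)) ^ w))"
    by (intro sum.cong refl summand) simp
  also have "\<dots> = P ^ (2 * s * i) / P ^ s * ((P - 1) * gauss_int s (P powi (1 - int i)))"
    by (simp only: gauss_int_def sum_distrib_left)
  also have "(P ^ (2 * s + 1)) ^ i * eig 0 1 1 = P ^ (2 * s * i) / P ^ s * P ^ i - P ^ ((2 * s + 1) * i) / phi"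
    by (simp add: eig_def a a0 power_mult[symmetric] power_add field_simps)
  finally show ?thesis unfolding e by (simp only: ring_distribs)
qed

lemma walks_eq_Phi:
  assumes "m \<ge> 2"
  shows "walks q (m - 1) 0 1 = Phi m (nat p) (Suc s)"
proof -
  have np: "(of_nat (nat p) :: rat) = P" using p_gt_1 by (simp add: P_def)
  have p2: "nat p = 2 \<longleftrightarrow> p = 2" using p_gt_1 by auto
  have unit: "\<not> p dvd 1" using prime_p by auto
  \<comment> \<open>The walk starts at \<open>(0, 1)\<close>, whose second coordinate is a unit, so
    its first step already leads into \<open>S\<close>.\<close>
  have "walks q (Suc (m - 2)) 0 1 = S (m - 2) 1" by (rule walks_Suc_unit[OF unit])
  moreover have "Suc (m - 2) = m - 1" using assms by simp
  ultimately have w: "walks q (m - 1) 0 1 = S (m - 2) 1" by simp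
  show ?thesis
  proof (cases "odd m")
    case True
    then obtain k where "m = 2 * k + 1" by (elim oddE)
    with assms obtain i where m: "m = 2 * i + 3" by (cases k) auto
    have "P powi (int s * (int m - 3)) = P ^ (s * (2 * i))"
      by (simp add: m flip: power_int_of_nat)
    then show ?thesis
      using S_odd[OF unit, of i] tot_odd_closed[of i] True unfolding w
      by (simp add: Phi_def Let_def np m)
  next
    case False
    then obtain k where "m = 2 * k" by auto
    with assms obtain i where m: "m = 2 * i + 2" by (cases k) auto
    have k: "m div 2 = Suc i" by (simp add: m)
    have "int s * (int m - 3) = int (2 * s * i) - int s" by (simp add: m algebra_simps)
    then have c: "P powi (int s * (int m - 3)) = P ^ (2 * s * i) / P ^ s"
      using P_pos by (simp add: power_int_diff del: of_nat_mult)
    have S: "S (m - 2) 1 = P ^ (2 * s * i) / P ^ s * ((P - 1) * gauss_binomial2 (Suc i) P)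
      + P ^ ((2 * s + 1) * i) / phi
      + (\<Sum>j\<le>s. (P ^ (2 * s + 1 - j)) ^ i * eig j ((-1) ^ i) 1)"
      using S_even[OF unit, of i] tot_even_closed[of i] by (simp add: m)
    show ?thesis
    proof (cases "even i")
      case True
      then show ?thesis unfolding w S sum_eig_even[OF True]
        using False c by (simp add: Phi_def Let_def np k ring_distribs)
    next
      case odd: False
      \<comment> \<open>Now \<open>k\<close> is even. For \<open>p = 2\<close> and
        \<open>s = 0\<close> the last case of \<open>Phi\<close> applies, and its
        \<open>gauss_int\<close> term is an empty sum.\<close>
      then show ?thesis unfolding w S sum_eig_odd[OF odd]
        using False c by (auto simp: Phi_def Let_def np k p2 ring_distribs gauss_int_def)
    qed
  qed
qed

end

lemma walks_prime_power_eq_Phi: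
  assumes "prime p" "r > 0" "m \<ge> 2"
  shows "walks (int p ^ r) (m - 1) 0 1 = Phi m p r"
proof -
  obtain s where s: "r = Suc s" using assms(2) by (cases r) auto
  interpret prime_power_modulus "int p" s by unfold_locales (use assms in simp)
  show ?thesis using walks_eq_Phi[OF assms(3)] by (simp add: s q_def)
qed

section \<open>Quiddities\<close>

text \<open>For \<open>i > 0\<close> this is the determinant of the tridiagonal matrix with diagonal
  \<open>c (u + 1), ..., c (u + i - 1)\<close> and ones beside it. The index exceeds the size by
  one, so that it is the row of the corresponding frieze entry.\<close>

fun continuant :: "(int \<Rightarrow> int) \<Rightarrow> int \<Rightarrow> nat \<Rightarrow> int" where
  "continuant c u 0 = 0"
| "continuant c u (Suc 0) = 1"
| "continuant c u (Suc (Suc i)) = c (u + int i + 1) * continuant c u (Suc i) - continuant c u i"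

text \<open>The determinant is expanded at its first row instead of its last.\<close>

lemma continuant_left:
  "continuant c u (Suc (Suc i)) = c (u + 1) * continuant c (u + 1) (Suc i) - continuant c (u + 2) i"
proof (induction i rule: induct_nat_012)
  case (ge2 i)
  have "continuant c u (Suc (Suc (Suc (Suc i))))
    = c (u + int i + 3) * continuant c u (Suc (Suc (Suc i))) - continuant c u (Suc (Suc i))"
    by (simp add: add_ac)
  also have "\<dots> = c (u + 1) * (c (u + int i + 3) * continuant c (u + 1) (Suc (Suc i)) - continuant c (u + 1) (Suc i))
      - (c (u + int i + 3) * continuant c (u + 2) (Suc i) - continuant c (u + 2) i)"
    unfolding ge2 by (simp add: algebra_simps)
  finally show ?case by (simp add: add_ac)
qed (auto simp: add_ac)

text \<open>This is the frieze rule over the integers; by the recurrence the minor does not change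
  with \<open>i\<close>.\<close>

lemma continuant_unimodular:
  "continuant c u (Suc i) * continuant c (u + 1) (Suc i) - continuant c (u + 1) i * continuant c u (Suc (Suc i)) = 1"
proof (induction i)
  case (Suc i)
  have "continuant c u (Suc (Suc i)) * continuant c (u + 1) (Suc (Suc i))
      - continuant c (u + 1) (Suc i) * continuant c u (Suc (Suc (Suc i)))
    = continuant c u (Suc i) * continuant c (u + 1) (Suc i) - continuant c (u + 1) i * continuant c u (Suc (Suc i))"
    by (simp only: continuant.simps(3)[of c u "Suc i"] continuant.simps(3)[of c "u + 1" i])
       (simp add: algebra_simps)
  then show ?case using Suc by simp
qed simp

lemma continuant_cong:
  "(\<And>i. 0 < i \<Longrightarrow> i < k \<Longrightarrow> c (u + int i) = d (u + int i)) \<Longrightarrow> continuant c u k = continuant d u k"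
proof (induction k rule: induct_nat_012)
  case (ge2 k)
  have "c (u + int k + 1) = d (u + int k + 1)" using ge2(3)[of "Suc k"] by (simp add: add_ac)
  then show ?case using ge2 by simp
qed auto

text \<open>The two congruences close the frieze: from every starting point \<open>u\<close> they
  put 0 into the last row and 1 into the row before it.\<close>

definition quiddities :: "int \<Rightarrow> nat \<Rightarrow> (int \<Rightarrow> int) set" where
  "quiddities n m = {c. (\<forall>v. c v \<in> {0..<n}) \<and>
     (\<forall>u. [continuant c u m = 0] (mod n) \<and> [continuant c u (m - 1) = 1] (mod n))}"

text \<open>One vanishing continuant is expanded at its right end, another at its left end. In both
  the new coefficient is multiplied by 1 and the same inner continuant is left, so \<open>c\<close>
  has period \<open>Suc (Suc k)\<close>.\<close>

lemma quiddity_period: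
  assumes c: "c \<in> quiddities n (Suc (Suc k))"
  shows "[c (u + 2 + int k) = continuant c (u + 1) k] (mod n)" and "[c u = continuant c (u + 1) k] (mod n)"
proof -
  have 0: "[continuant c v (Suc (Suc k)) = 0] (mod n)" and 1: "[continuant c v (Suc k) = 1] (mod n)" for v
    using c by (auto simp: quiddities_def)
  have "[c (u + 2 + int k) * continuant c (u + 1) (Suc k) - continuant c (u + 1) k = 0] (mod n)"
    using 0[of "u + 1"] by (simp add: add_ac)
  moreover have "[c (u + 2 + int k) * continuant c (u + 1) (Suc k) - continuant c (u + 1) k
     = c (u + 2 + int k) * 1 - continuant c (u + 1) k] (mod n)"
    by (intro cong_diff cong_mult cong_refl 1)
  ultimately show "[c (u + 2 + int k) = continuant c (u + 1) k] (mod n)"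
    by (metis cong_diff_iff_cong_0 cong_sym cong_trans mult.right_neutral)
  have "[c u * continuant c u (Suc k) - continuant c (u + 1) k = 0] (mod n)"
    using 0[of "u - 1"] continuant_left[of c "u - 1" k] by (simp add: add_ac)
  moreover have "[c u * continuant c u (Suc k) - continuant c (u + 1) k = c u * 1 - continuant c (u + 1) k] (mod n)"
    by (intro cong_diff cong_mult cong_refl 1)
  ultimately show "[c u = continuant c (u + 1) k] (mod n)"
    by (metis cong_diff_iff_cong_0 cong_sym cong_trans mult.right_neutral)
qed

section \<open>Coefficient lists of walks and their bijection with quiddities\<close>

fun admissible :: "int \<Rightarrow> int \<Rightarrow> int \<Rightarrow> int list \<Rightarrow> bool" where
  "admissible n a b [] \<longleftrightarrow> [a = 1] (mod n) \<and> [b = 0] (mod n)"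
| "admissible n a b (c # cs) \<longleftrightarrow> admissible n b (c * b - a) cs"

definition admissible_lists :: "int \<Rightarrow> nat \<Rightarrow> int \<Rightarrow> int \<Rightarrow> int list set" where
  "admissible_lists n k a b = {cs. length cs = k \<and> set cs \<subseteq> {0..<n} \<and> admissible n a b cs}"

lemma finite_admissible_lists: "finite (admissible_lists n k a b)"
  by (rule finite_subset[OF _ finite_lists_length_eq[of "{0..<n}" k]])
     (auto simp: admissible_lists_def)

lemma card_admissible_lists: "of_nat (card (admissible_lists n k a b)) = walks n k a b"
proof (induction k arbitrary: a b)
  case 0
  have "admissible_lists n 0 a b = (if [a = 1] (mod n) \<and> [b = 0] (mod n) then {[]} else {})"
    by (auto simp: admissible_lists_def)
  then show ?case by auto
next
  case (Suc k)
  have eq: "admissible_lists n (Suc k) a b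
    = (\<Union>c\<in>{0..<n}. (#) c ` admissible_lists n k b (c * b - a))"
    by (auto simp: admissible_lists_def length_Suc_conv image_iff)
  have "card (admissible_lists n (Suc k) a b)
    = (\<Sum>c\<in>{0..<n}. card ((#) c ` admissible_lists n k b (c * b - a)))"
    unfolding eq by (rule card_UN_disjoint) (auto simp: finite_admissible_lists)
  also have "\<dots> = (\<Sum>c\<in>{0..<n}. card (admissible_lists n k b (c * b - a)))"
    by (intro sum.cong refl card_image) (auto simp: inj_on_def)
  finally show ?case by (simp add: Suc.IH)
qed

text \<open>Two consecutive continuants are the state of the walk, and each coefficient of the list
  advances their index by one.\<close>

lemma admissible_continuant:
  "admissible n (continuant c u i) (continuant c u (Suc i)) (map (\<lambda>j. c (u + int j)) [Suc i..<Suc (i + k)])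
    \<longleftrightarrow> [continuant c u (i + k) = 1] (mod n) \<and> [continuant c u (Suc (i + k)) = 0] (mod n)"
proof (induction k arbitrary: i)
  case (Suc k)
  have "[Suc i..<Suc (i + Suc k)] = Suc i # [Suc (Suc i)..<Suc (Suc i + k)]"
    by (subst upt_conv_Cons) auto
  then show ?case using Suc.IH[of "Suc i"] by (simp add: add_ac)
qed simp

definition quiddity_list :: "nat \<Rightarrow> (int \<Rightarrow> int) \<Rightarrow> int list" where
  "quiddity_list m c = map (\<lambda>j. c (int j)) [1..<m]"

text \<open>Injectivity: the list determines \<open>c 0\<close> through the inner continuant, and
  periodicity gives the rest. Surjectivity: the periodic extension of a list, with that forced value
  at 0, closes at every starting point.\<close>

lemma bij_betw_quiddity_list:
  assumes n: "n > 0"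
  shows "bij_betw (quiddity_list (Suc (Suc k))) (quiddities n (Suc (Suc k)))
     (admissible_lists n (Suc k) 0 1)"
  (is "bij_betw ?f ?Q ?L")
proof (rule bij_betw_imageI)
  let ?m = "int k + 2"
  show "inj_on ?f ?Q"
  proof (rule inj_onI)
    fix c d assume c: "c \<in> ?Q" and d: "d \<in> ?Q" and eq: "?f c = ?f d"
    have range: "c v \<in> {0..<n}" "d v \<in> {0..<n}" for v using c d by (auto simp: quiddities_def)
    have cong_eq: "c v = d w" if "[c v = d w] (mod n)" for v w
      using that range by (simp add: cong_def)
    have per: "c (v + ?m) = c v" "d (v + ?m) = d v" for v
      using quiddity_period[OF c, of v] quiddity_period[OF d, of v] range[of v] range[of "v + ?m"]
      by (auto simp: cong_def add_ac)
    have mid: "c (int j) = d (int j)" if "0 < j" "j < Suc (Suc k)" for j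
      using eq that by (auto simp: quiddity_list_def simp del: upt_Suc)
    have "continuant c 1 k = continuant d 1 k"
    proof (rule continuant_cong)
      fix i :: nat assume "0 < i" "i < k"
      then show "c (1 + int i) = d (1 + int i)" using mid[of "Suc i"] by simp
    qed
    then have zero: "c 0 = d 0"
      using quiddity_period(2)[OF c, of 0] quiddity_period(2)[OF d, of 0]
      by (intro cong_eq) (auto simp: cong_def)
    have base: "c w = d w" if "0 \<le> w" "w < ?m" for w
      using mid[of "nat w"] zero that by (cases "w = 0") auto
    have iter: "c (w + int t * ?m) = c w \<and> d (w + int t * ?m) = d w" for w t
    proof (induction t)
      case (Suc t)
      have "w + int (Suc t) * ?m = (w + int t * ?m) + ?m" by (simp add: algebra_simps)
      then show ?case using Suc per by metis
    qed simp
    show "c = d"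
    proof
      fix v
      have "c (v mod ?m) = d (v mod ?m)" by (rule base) auto
      moreover have "c v = c (v mod ?m) \<and> d v = d (v mod ?m)"
      proof (cases "v div ?m \<ge> 0")
        case True
        have "v mod ?m + int (nat (v div ?m)) * ?m = v"
          using True mod_div_mult_eq[of v ?m] by simp
        then show ?thesis using iter[of "v mod ?m" "nat (v div ?m)"] by simp
      next
        case False
        have "v + int (nat (- (v div ?m))) * ?m = v mod ?m"
          using False mod_div_mult_eq[of v ?m] by (simp add: algebra_simps)
        then show ?thesis using iter[of v "nat (- (v div ?m))"] by simp
      qed
      ultimately show "c v = d v" by simp
    qed
  qed
  show "?f ` ?Q = ?L"
  proof (intro equalityI subsetI)
    fix cs assume "cs \<in> ?f ` ?Q"
    then obtain c where c: "c \<in> ?Q" and cs: "cs = ?f c" by blast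
    have "admissible n 0 1 cs"
      using admissible_continuant[of n c 0 0 "Suc k"] c by (simp add: cs quiddity_list_def quiddities_def del: continuant.simps(3) upt_Suc)
    then show "cs \<in> ?L"
      using c by (auto simp: admissible_lists_def cs quiddity_list_def quiddities_def)
  next
    fix cs assume cs: "cs \<in> ?L"
    then have len: "length cs = Suc k" by (simp add: admissible_lists_def)
    \<comment> \<open>The value of \<open>c\<close> at 0 is a continuant of the inner entries, so
      these are first stored in \<open>d\<close>; its default 0 is never read by
      \<open>c\<close>.\<close>
    define d where "d v = (if 0 < v \<and> v < ?m then cs ! nat (v - 1) else 0)" for v
    define c where "c v = (if v mod ?m = 0 then continuant d 1 k mod n else d (v mod ?m))" for v
    have range: "c v \<in> {0..<n}" for v
    proof -
      have "set cs \<subseteq> {0..<n}" using cs by (simp add: admissible_lists_def)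
      then have "cs ! nat (v - 1) \<in> {0..<n}" if "0 < v" "v < ?m" for v
        using that len by (elim subsetD) (auto intro!: nth_mem)
      then have "d v \<in> {0..<n}" for v
        using n unfolding d_def by simp
      then show ?thesis using n by (auto simp: c_def)
    qed
    have per: "c (v + ?m) = c v" for v by (simp add: c_def)
    have cd: "c v = d v" if "0 < v" "v < ?m" for v using that by (simp add: c_def)
    have fc: "?f c = cs"
      using len by (auto simp: quiddity_list_def list_eq_iff_nth_eq cd d_def simp del: upt_Suc)
    have c0: "c 0 = continuant c 1 k mod n"
    proof -
      have "continuant c 1 k = continuant d 1 k" by (rule continuant_cong) (auto intro: cd)
      then show ?thesis by (simp add: c_def)
    qed
    define good where "good u \<longleftrightarrow> [continuant c u (Suc (Suc k)) = 0] (mod n) \<and> [continuant c u (Suc k) = 1] (mod n)" for u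
    have good0: "good 0"
      using admissible_continuant[of n c 0 0 "Suc k"] cs fc
      by (simp add: good_def quiddity_list_def admissible_lists_def del: continuant.simps(3) upt_Suc)
    \<comment> \<open>Modulo \<open>n\<close> the unimodular relation at a closed \<open>u\<close>
      forces the next continuant to be 1; periodicity of \<open>c\<close> then makes the longer one
      vanish.\<close>
    have step: "good (u + 1)" if u: "good u" and cu: "[c u = continuant c (u + 1) k] (mod n)" for u
    proof -
      have "[continuant c u (Suc k) * continuant c (u + 1) (Suc k) - continuant c (u + 1) k * continuant c u (Suc (Suc k))
         = 1 * continuant c (u + 1) (Suc k) - continuant c (u + 1) k * 0] (mod n)"
        using u unfolding good_def by (intro cong_diff cong_mult cong_refl) auto
      then have 1: "[continuant c (u + 1) (Suc k) = 1] (mod n)"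
        unfolding continuant_unimodular by (simp add: cong_sym)
      have "[c (u + ?m) * continuant c (u + 1) (Suc k) - continuant c (u + 1) k
         = continuant c (u + 1) k * 1 - continuant c (u + 1) k] (mod n)"
        using 1 cu unfolding per by (intro cong_diff cong_mult cong_refl) auto
      then have "[continuant c (u + 1) (Suc (Suc k)) = 0] (mod n)"
        by (simp add: add_ac)
      with 1 show ?thesis by (simp add: good_def)
    qed
    \<comment> \<open>Two consecutive closed starting points supply the premise of
      \<open>step\<close> at the second one.\<close>
    have coeff: "[c (u + 1) = continuant c (u + 2) k] (mod n)" if u: "good u" "good (u + 1)" for u
    proof -
      have "[c (u + 1) * continuant c (u + 1) (Suc k) - continuant c (u + 2) k = c (u + 1) * 1 - continuant c (u + 2) k] (mod n)"
        using u unfolding good_def by (intro cong_diff cong_mult cong_refl) auto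
      moreover have "[c (u + 1) * continuant c (u + 1) (Suc k) - continuant c (u + 2) k = 0] (mod n)"
        using u(1) unfolding good_def continuant_left by blast
      ultimately show ?thesis by (metis cong_diff_iff_cong_0 cong_sym cong_trans mult.right_neutral)
    qed
    have "good (int t) \<and> good (int t + 1)" for t
    proof (induction t)
      case 0
      have "good (0 + 1)" by (rule step[OF good0]) (simp add: c0 cong_def)
      then show ?case using good0 by simp
    next
      case (Suc t)
      then have "[c (int t + 1) = continuant c (int t + 1 + 1) k] (mod n)" using coeff[of "int t"] by (simp add: add_ac)
      then have "good (int t + 1 + 1)" using Suc step[of "int t + 1"] by blast
      then show ?case using Suc by (simp add: add_ac)
    qed
    then have good_nat: "good (int t)" for t by blast
    \<comment> \<open>Negative starting points are reached through their residues modulo the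
      period.\<close>
    have cmod: "c (v mod ?m + w) = c (v + w)" for v w
      by (simp add: c_def mod_add_left_eq)
    have continuant_mod: "continuant c (v mod ?m) i = continuant c v i" for v i
    proof (induction i rule: induct_nat_012)
      case (ge2 i)
      have "c (v mod ?m + int i + 1) = c (v + int i + 1)"
        using cmod[of v "int i + 1"] by (simp add: add.assoc)
      then show ?case using ge2 by simp
    qed auto
    have "good v" for v
    proof -
      have "good (v mod ?m)" using good_nat[of "nat (v mod ?m)"] by simp
      then show ?thesis by (simp add: good_def continuant_mod del: continuant.simps(3))
    qed
    then have "c \<in> ?Q" using range by (simp add: quiddities_def good_def del: continuant.simps(3))
    with fc show "cs \<in> ?f ` ?Q" by blast
  qed
qed

section \<open>Friezes and quiddities\<close>

lemma residue_ring_minor: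
  assumes "n > 1"
  shows "a \<otimes>\<^bsub>residue_ring n\<^esub> d \<ominus>\<^bsub>residue_ring n\<^esub> b \<otimes>\<^bsub>residue_ring n\<^esub> c = (a * d - b * c) mod n"
proof -
  interpret residues n "residue_ring n" by unfold_locales (use assms in simp_all)
  show ?thesis by (simp add: a_minus_def res_add_eq res_mult_eq res_neg_eq mod_simps)
qed

lemma mod_cong_self: "[x mod n = x] (mod n)" for x n :: int
  by (simp add: cong_def)

lemma residue_ring_det3:
  assumes "n > 1"
  shows "det3 (residue_ring n) A
    = (A 0 0 * (A 1 1 * A 2 2 - A 1 2 * A 2 1) - A 0 1 * (A 1 0 * A 2 2 - A 1 2 * A 2 0)
       + A 0 2 * (A 1 0 * A 2 1 - A 1 1 * A 2 0)) mod n"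
proof -
  interpret residues n "residue_ring n" by unfold_locales (use assms in simp_all)
  show ?thesis
    unfolding det3_def residue_ring_minor[OF assms]
    unfolding res_add_eq res_mult_eq cong_def[symmetric]
    by (intro cong_trans[OF mod_cong_self] cong_add cong_diff cong_mult cong_refl mod_cong_self)
qed

text \<open>In the lower two rows the third column is \<open>t\<close> times the second minus the
  first, and their left minor is 1. Expanding the vanishing determinant along the top row forces the
  same relation there.\<close>

lemma three_term_from_det:
  fixes a b x a' b' x' a'' b'' x'' t n :: int
  assumes x': "[x' = t * b' - a'] (mod n)" and x'': "[x'' = t * b'' - a''] (mod n)"
    and minor: "[a' * b'' - a'' * b' = 1] (mod n)"
    and det: "[a * (b' * x'' - x' * b'') - b * (a' * x'' - x' * a'') + x * (a' * b'' - b' * a'') = 0] (mod n)"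
  shows "[x = t * b - a] (mod n)"
proof -
  have "[b' * x'' - x' * b'' = b' * (t * b'' - a'') - (t * b' - a') * b''] (mod n)"
    by (intro cong_diff cong_mult cong_refl x' x'')
  also have "b' * (t * b'' - a'') - (t * b' - a') * b'' = a' * b'' - a'' * b'"
    by (simp add: algebra_simps)
  finally have 1: "[b' * x'' - x' * b'' = 1] (mod n)" using minor by (rule cong_trans)
  have "[a' * x'' - x' * a'' = a' * (t * b'' - a'') - (t * b' - a') * a''] (mod n)"
    by (intro cong_diff cong_mult cong_refl x' x'')
  also have "a' * (t * b'' - a'') - (t * b' - a') * a'' = t * (a' * b'' - a'' * b')"
    by (simp add: algebra_simps)
  also have "[\<dots> = t * 1] (mod n)" by (intro cong_mult cong_refl minor)
  finally have 2: "[a' * x'' - x' * a'' = t * 1] (mod n)" .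
  have 3: "[a' * b'' - b' * a'' = 1] (mod n)" using minor by (simp add: mult.commute)
  have "[a * (b' * x'' - x' * b'') - b * (a' * x'' - x' * a'') + x * (a' * b'' - b' * a'')
      = a * 1 - b * (t * 1) + x * 1] (mod n)"
    by (intro cong_add cong_diff cong_mult cong_refl 1 2 3)
  then have "[a * 1 - b * (t * 1) + x * 1 = 0] (mod n)"
    using det by (metis cong_sym cong_trans)
  moreover have "a * 1 - b * (t * 1) + x * 1 = x - (t * b - a)" by simp
  ultimately have "[x - (t * b - a) = 0] (mod n)" by (simp only:)
  then show ?thesis by (simp only: cong_diff_iff_cong_0)
qed

section \<open>Passing between a frieze and its quiddity\<close>

definition quiddity :: "(int \<times> int \<Rightarrow> int) \<Rightarrow> int \<Rightarrow> int" where
  "quiddity E v = E (v - 1, v + 1)"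

definition frieze_of :: "int \<Rightarrow> nat \<Rightarrow> (int \<Rightarrow> int) \<Rightarrow> int \<times> int \<Rightarrow> int" where
  "frieze_of n m c = restrict (\<lambda>(u, v). continuant c u (nat (v - u)) mod n) (strip m)"

lemma frieze_of_apply:
  "i \<le> m \<Longrightarrow> v = u + int i \<Longrightarrow> frieze_of n m c (u, v) = continuant c u i mod n"
  by (simp add: frieze_of_def strip_def)

text \<open>Induction on the row: the zeros and ones at the boundary give \<open>i = 0\<close>, the
  frieze rule gives \<open>i = 1\<close>, and for larger \<open>i\<close> tameness carries the
  relation from the starting points \<open>u + 1\<close> and \<open>u + 2\<close> to
  \<open>u\<close>.\<close>

lemma frieze_three_term:
  assumes n: "n > 1" and E: "E \<in> regular_tame_friezes (residue_ring n) m"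
    and "i + 2 \<le> m"
  shows "[E (u, u + int i + 2) = quiddity E (u + int i + 1) * E (u, u + int i + 1) - E (u, u + int i)] (mod n)"
  using assms(3)
proof (induction i arbitrary: u rule: less_induct)
  case (less i)
  have minor: "[E (u, v) * E (u + 1, v + 1) - E (u + 1, v) * E (u, v + 1) = 1] (mod n)"
    if "1 \<le> v - u" "v - u \<le> int m - 1" for u v
    using E that n unfolding regular_tame_friezes_def is_frieze_def residue_ring_minor[OF n]
    by (auto simp: cong_def residue_ring_def)
  have E0: "E (u, u) = 0" and E1: "E (u, u + 1) = 1" for u
    using E unfolding regular_tame_friezes_def is_frieze_def is_regular_def
    by (auto simp: residue_ring_def)
  consider "i = 0" | "i = 1" | j where "i = Suc (Suc j)" by (cases i; cases "i - 1") auto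
  then show ?case
  proof cases
    case 1
    then show ?thesis using E0[of u] E1[of u] by (simp add: quiddity_def add_ac)
  next
    case 2
    have "[E (u, u + 2) * E (u + 1, u + 3) - E (u + 1, u + 2) * E (u, u + 3) = 1] (mod n)"
      using minor[of "u + 2" u] less.prems 2 by (simp add: add_ac)
    moreover have "E (u + 1, u + 2) = 1" using E1[of "u + 1"] by (simp add: add_ac)
    ultimately have "[E (u, u + 2) * E (u + 1, u + 3) - E (u, u + 3) = 1] (mod n)" by simp
    then have "[E (u, u + 3) = E (u + 1, u + 3) * E (u, u + 2) - 1] (mod n)"
      by (smt (verit) cong_iff_dvd_diff dvd_minus_iff mult.commute)
    then show ?thesis using 2 E1[of u] by (simp add: quiddity_def add_ac)
  next
    case 3
    define v where "v = u + int i"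
    let ?t = "quiddity E (v + 1)"
    have "[E (u + 1, v + 2) = ?t * E (u + 1, v + 1) - E (u + 1, v)] (mod n)"
      using less.IH[of "Suc j" "u + 1"] less.prems 3 by (simp add: v_def add_ac)
    moreover have "[E (u + 2, v + 2) = ?t * E (u + 2, v + 1) - E (u + 2, v)] (mod n)"
      using less.IH[of j "u + 2"] less.prems 3 by (simp add: v_def add_ac)
    moreover have "[E (u + 1, v) * E (u + 2, v + 1) - E (u + 2, v) * E (u + 1, v + 1) = 1] (mod n)"
      using minor[of v "u + 1"] less.prems 3 by (simp add: v_def add_ac)
    moreover have "[E (u, v) * (E (u + 1, v + 1) * E (u + 2, v + 2) - E (u + 1, v + 2) * E (u + 2, v + 1))
       - E (u, v + 1) * (E (u + 1, v) * E (u + 2, v + 2) - E (u + 1, v + 2) * E (u + 2, v))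
       + E (u, v + 2) * (E (u + 1, v) * E (u + 2, v + 1) - E (u + 1, v + 1) * E (u + 2, v)) = 0] (mod n)"
    proof -
      have "2 \<le> v - u \<and> v - u \<le> int m - 2" using less.prems 3 by (simp add: v_def)
      then have "det3 (residue_ring n) (\<lambda>i j. E (u + int i, v + int j)) = 0"
        using E unfolding regular_tame_friezes_def is_tame_def by (auto simp: residue_ring_def)
      then show ?thesis unfolding residue_ring_det3[OF n] by (simp add: cong_def)
    qed
    ultimately show ?thesis
      using three_term_from_det[where a = "E (u, v)" and b = "E (u, v + 1)" and x = "E (u, v + 2)"
          and a' = "E (u + 1, v)" and b' = "E (u + 1, v + 1)" and x' = "E (u + 1, v + 2)"
          and a'' = "E (u + 2, v)" and b'' = "E (u + 2, v + 1)" and x'' = "E (u + 2, v + 2)"]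
      unfolding v_def by blast
  qed
qed

lemma frieze_entries:
  assumes n: "n > 1" and E: "E \<in> regular_tame_friezes (residue_ring n) m" and "i \<le> m"
  shows "E (u, u + int i) = continuant (quiddity E) u i mod n"
proof -
  have E0: "E (u, u) = 0" and E1: "E (u, u + 1) = 1"
    using E unfolding regular_tame_friezes_def is_frieze_def is_regular_def
    by (auto simp: residue_ring_def)
  have "[E (u, u + int i) = continuant (quiddity E) u i] (mod n)"
    using assms(3)
  proof (induction i rule: induct_nat_012)
    case (ge2 i)
    have "[E (u, u + int i + 2)
        = quiddity E (u + int i + 1) * E (u, u + int i + 1) - E (u, u + int i)] (mod n)"
      using ge2.prems by (intro frieze_three_term[OF n E]) simp
    also have "[quiddity E (u + int i + 1) * E (u, u + int i + 1) - E (u, u + int i)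
        = continuant (quiddity E) u (Suc (Suc i))] (mod n)"
      unfolding continuant.simps(3) using ge2 by (intro cong_diff cong_mult cong_refl) (auto simp: add_ac)
    finally show ?case by (simp add: add_ac)
  qed (use E0 E1 in auto)
  \<comment> \<open>The entry is a reduced residue, so the congruence becomes an equality.\<close>
  moreover have "E (u, u + int i) \<in> {0..<n}"
  proof -
    have "(u, u + int i) \<in> strip m" using assms(3) by (simp add: strip_def)
    then have "E (u, u + int i) \<in> carrier (residue_ring n)"
      using E unfolding regular_tame_friezes_def is_frieze_def by auto
    then show ?thesis by (auto simp: residue_ring_def)
  qed
  ultimately show ?thesis by (simp add: cong_def)
qed

lemma quiddity_in_quiddities:
  assumes n: "n > 1" and m: "m \<ge> 2" and E: "E \<in> regular_tame_friezes (residue_ring n) m"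
  shows "quiddity E \<in> quiddities n m"
proof -
  have "quiddity E v \<in> {0..<n}" for v
  proof -
    have "(v - 1, v + 1) \<in> strip m" using m by (simp add: strip_def)
    then have "E (v - 1, v + 1) \<in> carrier (residue_ring n)"
      using E unfolding regular_tame_friezes_def is_frieze_def by auto
    then show ?thesis by (auto simp: residue_ring_def quiddity_def)
  qed
  moreover have "E (u, u + int m) = 0" "E (u, u + int (m - 1)) = 1" for u
    using E m unfolding regular_tame_friezes_def is_frieze_def is_regular_def
    by (auto simp: residue_ring_def of_nat_diff algebra_simps)
  then have "continuant (quiddity E) u m mod n = 0" "continuant (quiddity E) u (m - 1) mod n = 1" for u
    using frieze_entries[OF n E] m by (metis diff_le_self le_refl)+
  ultimately show ?thesis using n by (simp add: quiddities_def cong_def)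
qed

lemma frieze_of_quiddity:
  assumes n: "n > 1" and E: "E \<in> regular_tame_friezes (residue_ring n) m"
  shows "frieze_of n m (quiddity E) = E"
proof (rule extensionalityI[of _ "strip m"])
  show "frieze_of n m (quiddity E) \<in> extensional (strip m)" by (simp add: frieze_of_def)
  show "E \<in> extensional (strip m)"
    using E unfolding regular_tame_friezes_def is_frieze_def by (auto simp: PiE_def)
next
  fix x assume x: "x \<in> strip m"
  obtain u v where uv: "x = (u, v)" by (cases x)
  define i where "i = nat (v - u)"
  have i: "i \<le> m" "v = u + int i" using x uv by (auto simp: i_def strip_def)
  show "frieze_of n m (quiddity E) x = E x"
    unfolding uv using frieze_of_apply[OF i] frieze_entries[OF n E i(1)] i(2) by simp
qed

lemma quiddity_frieze_of:
  assumes n: "n > 1" and m: "m \<ge> 2" and c: "c \<in> quiddities n m"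
  shows "quiddity (frieze_of n m c) = c"
proof
  fix v
  have "frieze_of n m c (v - 1, v + 1) = continuant c (v - 1) (Suc (Suc 0)) mod n"
    using m by (intro frieze_of_apply) auto
  also have "\<dots> = c v" using c by (simp add: quiddities_def)
  finally show "quiddity (frieze_of n m c) v = c v" by (simp add: quiddity_def)
qed

lemma frieze_of_in_friezes:
  assumes n: "n > 1" and m: "m \<ge> 2" and c: "c \<in> quiddities n m"
  shows "frieze_of n m c \<in> regular_tame_friezes (residue_ring n) m"
proof -
  let ?E = "frieze_of n m c"
  note app = frieze_of_apply[of _ m _ _ n c]
  have bd: "continuant c u m mod n = 0" "continuant c u (m - 1) mod n = 1" for u
    using c n by (auto simp: quiddities_def cong_def)
  have "?E (u, u) = 0" "?E (u, u + int m) = 0" for u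
    using app[of 0 u u] app[of m "u + int m" u] bd by auto
  moreover have "?E \<in> strip m \<rightarrow>\<^sub>E carrier (residue_ring n)"
    using n by (auto simp: frieze_of_def residue_ring_def)
  moreover have "(?E (u, v) * ?E (u + 1, v + 1) - ?E (u + 1, v) * ?E (u, v + 1)) mod n = 1"
    if uv: "1 \<le> v - u" "v - u \<le> int m - 1" for u v
  proof -
    define i where "i = nat (v - u - 1)"
    have v: "v = u + int i + 1" and i: "Suc (Suc i) \<le> m" using uv by (auto simp: i_def)
    have "?E (u, v) = continuant c u (Suc i) mod n" "?E (u + 1, v + 1) = continuant c (u + 1) (Suc i) mod n"
      "?E (u + 1, v) = continuant c (u + 1) i mod n" "?E (u, v + 1) = continuant c u (Suc (Suc i)) mod n"
      using i v by (auto intro!: app simp del: continuant.simps(3))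
    then have "(?E (u, v) * ?E (u + 1, v + 1) - ?E (u + 1, v) * ?E (u, v + 1)) mod n
      = (continuant c u (Suc i) * continuant c (u + 1) (Suc i) - continuant c (u + 1) i * continuant c u (Suc (Suc i))) mod n"
      unfolding cong_def[symmetric]
      by (simp only:) (intro cong_diff cong_mult mod_cong_self)
    also have "\<dots> = 1" unfolding continuant_unimodular using n by simp
    finally show ?thesis .
  qed
  ultimately have "is_frieze (residue_ring n) m ?E"
    unfolding is_frieze_def residue_ring_minor[OF n] by (simp add: residue_ring_def)
  moreover have "is_tame (residue_ring n) m ?E"
    unfolding is_tame_def residue_ring_det3[OF n]
  proof (intro allI impI)
    fix u v :: int assume uv: "2 \<le> v - u \<and> v - u \<le> int m - 2"
    define j where "j = nat (v - u - 2)"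
    have v: "v = u + int j + 2" and j: "j + 4 \<le> m" using uv by (auto simp: j_def)
    \<comment> \<open>All three rows obey the recurrence with the same coefficient
      \<open>c (v + 1)\<close>, so the third column is a combination of the other two.\<close>
    have col: "?E (w, v + 2) = (c (v + 1) * continuant c w (Suc i) - continuant c w i) mod n"
      "?E (w, v + 1) = continuant c w (Suc i) mod n" "?E (w, v) = continuant c w i mod n"
      if "v = w + int i" "i + 2 \<le> m" for w i
      using app[of "Suc (Suc i)" "v + 2" w] app[of "Suc i" "v + 1" w] app[of i v w] that
      by (simp_all add: add_ac)
    have 0: "v = u + int (j + 2)" "v = u + 1 + int (j + 1)" "v = u + 2 + int j" using v by auto
    have j': "j + 2 + 2 \<le> m" "j + 1 + 2 \<le> m" "j + 2 \<le> m" using j by auto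
    note cols = col[OF 0(1) j'(1)] col[OF 0(2) j'(2)] col[OF 0(3) j'(3)]
    have *: "(a mod n * (b' mod n * ((t * b'' - a'') mod n) - (t * b' - a') mod n * (b'' mod n))
       - b mod n * (a' mod n * ((t * b'' - a'') mod n) - (t * b' - a') mod n * (a'' mod n))
       + (t * b - a) mod n * (a' mod n * (b'' mod n) - b' mod n * (a'' mod n))) mod n = 0"
      (is "?M mod n = 0") for a b a' b' a'' b'' t :: int
    proof -
      have "[?M = a * (b' * (t * b'' - a'') - (t * b' - a') * b'')
         - b * (a' * (t * b'' - a'') - (t * b' - a') * a'')
         + (t * b - a) * (a' * b'' - b' * a'')] (mod n)"
        by (intro cong_add cong_diff cong_mult mod_cong_self)
      also have "a * (b' * (t * b'' - a'') - (t * b' - a') * b'')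
         - b * (a' * (t * b'' - a'') - (t * b' - a') * a'')
         + (t * b - a) * (a' * b'' - b' * a'') = 0"
        by (simp add: algebra_simps)
      finally show ?thesis by (simp only: cong_def mod_0)
    qed
    have zero: "\<zero>\<^bsub>residue_ring n\<^esub> = 0" by (simp add: residue_ring_def)
    show "(?E (u + int 0, v + int 0) * (?E (u + int 1, v + int 1) * ?E (u + int 2, v + int 2)
        - ?E (u + int 1, v + int 2) * ?E (u + int 2, v + int 1))
       - ?E (u + int 0, v + int 1) * (?E (u + int 1, v + int 0) * ?E (u + int 2, v + int 2)
        - ?E (u + int 1, v + int 2) * ?E (u + int 2, v + int 0))
       + ?E (u + int 0, v + int 2) * (?E (u + int 1, v + int 0) * ?E (u + int 2, v + int 1)
        - ?E (u + int 1, v + int 1) * ?E (u + int 2, v + int 0))) mod n = \<zero>\<^bsub>residue_ring n\<^esub>"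
      unfolding of_nat_0 of_nat_1 of_nat_numeral add_0_right cols zero
      by (rule *)
  qed
  moreover have "is_regular (residue_ring n) m ?E"
  proof -
    have "?E (u, u + 1) = 1" "?E (u, u + int m - 1) = 1" for u
      using app[of 1 "u + 1" u] app[of "m - 1" "u + int m - 1" u] bd m n by (auto simp: of_nat_diff)
    then show ?thesis by (simp add: is_regular_def residue_ring_def)
  qed
  ultimately show ?thesis by (simp add: regular_tame_friezes_def)
qed

section \<open>The final count\<close>

lemma bij_betw_quiddity:
  assumes "n > 1" "m \<ge> 2"
  shows "bij_betw quiddity (regular_tame_friezes (residue_ring n) m) (quiddities n m)"
  using assms
  by (intro bij_betw_byWitness[where f' = "frieze_of n m"])
     (auto simp: frieze_of_quiddity quiddity_frieze_of quiddity_in_quiddities frieze_of_in_friezes)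

lemma card_regular_tame_friezes:
  assumes "n > 1" "m \<ge> 2"
  shows "of_nat (card (regular_tame_friezes (residue_ring n) m)) = walks n (m - 1) 0 1"
proof -
  obtain k where m: "m = Suc (Suc k)" using assms(2) by (metis Suc_le_D add_2_eq_Suc le_Suc_ex)
  have "card (regular_tame_friezes (residue_ring n) m) = card (admissible_lists n (Suc k) 0 1)"
    using bij_betw_same_card[OF bij_betw_quiddity[OF assms]]
      bij_betw_same_card[OF bij_betw_quiddity_list[of n k]] assms(1) by (simp add: m)
  then show ?thesis by (simp only: card_admissible_lists) (simp add: m)
qed

theorem theoremB:
  fixes n m :: nat
  assumes "n \<ge> 2" and "m \<ge> 2"
  shows "(of_nat (card (regular_tame_friezes (residue_ring (int n)) m)) :: rat)
         = (\<Prod>p\<in>prime_factors n. Phi m p (multiplicity p n))"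
proof -
  have "(of_nat (card (regular_tame_friezes (residue_ring (int n)) m)) :: rat)
      = walks (int n) (m - 1) 0 1"
    using assms by (intro card_regular_tame_friezes) auto
  also have "\<dots> = (\<Prod>p\<in>prime_factors n. walks (int p ^ multiplicity p n) (m - 1) 0 1)"
    using assms by (intro walks_prime_factors) auto
  also have "\<dots> = (\<Prod>p\<in>prime_factors n. Phi m p (multiplicity p n))"
    using assms(2)
    by (intro prod.cong refl walks_prime_power_eq_Phi)
       (auto simp: prime_factors_multiplicity)
  finally show ?thesis .
qed

end
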